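(* For every $M\in\Lambda^{001}$, $\mathrm{NF}_r(\mathcal T(M))=\mathcal T(\mathrm{BT}(M))$, where $\mathrm{NF}_r(\mathcal S)=\bigcup_{s\in\mathcal S}\mathrm{nf}_r(s)$.
   Context: $\Lambda_\bot^{001}$: possibly infinite trees built from variables, a constant $\bot$, abstractions and applications $(M)N$, whose infinite branches all enter infinitely often the argument position $N$ of an application, up to α-equivalence; $\Lambda^{001}$ consists of those without $\bot$. $\longrightarrow_\beta^*$ is the reflexive-transitive closure of one-step β-reduction; $\longrightarrow_\beta^\infty$ is defined by the rules (var) $M\longrightarrow_\beta^* x\Rightarrow M\longrightarrow_\beta^\infty x$, (λ) $M\longrightarrow_\beta^*\lambda x.P$, $P\longrightarrow_\beta^\infty P'\Rightarrow M\longrightarrow_\beta^\infty\lambda x.P'$, (@) $M\longrightarrow_\beta^*(P)Q$, $P\longrightarrow_\beta^\infty P'$, $Q\longrightarrow_\beta^\infty Q'\Rightarrow M\longrightarrow_\beta^\infty(P')Q'$, with possibly infinite derivations in which every infinite branch crosses infinitely often the third premise of (@). $M$ is solvable if $(\dots((\lambda x_1\dots\lambda x_m.M)N_1)\dots)N_n\longrightarrow_\beta^\infty\lambda x.x$ for some variables and terms, unsolvable otherwise. Head reduction $\longrightarrow_h$ contracts the redex $(\lambda z.N)P$ in $\lambda x_1\dots\lambda x_m.(\dots((\lambda z.N)P)Q_1\dots)Q_n$. The Böhm tree $\mathrm{BT}(M)\in\Lambda_\bot^{001}$ is defined corecursively: if $M$ is solvable and $M\longrightarrow_h^*\lambda x_1\dots\lambda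 x_m.(\dots((y)M_1)\dots)M_n$ then $\mathrm{BT}(M)=\lambda x_1\dots\lambda x_m.(\dots((y)\mathrm{BT}(M_1))\dots)\mathrm{BT}(M_n)$; otherwise $\mathrm{BT}(M)=\bot$. Resource terms: $s::=x\mid\lambda x.s\mid\langle s\rangle\bar t$, $\bar t$ a finite multiset; finite sums are finite sets of resource terms; resource reduction $\longmapsto_r$ is generated by $\langle\lambda x.s\rangle\bar t\longmapsto_r s\langle\bar t/x\rangle$ (for $\bar t=[t_1,\dots,t_n]$: sum over $\sigma\in\mathfrak S_n$ of the linear substitutions of $t_{\sigma(i)}$ for the $i$-th free occurrence of $x$ when $x$ has exactly $n$ free occurrences in $s$, and $0$ otherwise) and closed under all contexts; on finite sums, $\sum_{i=0}^n s_i\longrightarrow_r\sum_{i=0}^n T_i$ when $s_0\longmapsto_r T_0$ and each other $s_i$ either reduces to $T_i$ or equals it. This reduction is confluent and weakly normalising; $\mathrm{nf}_r(s)$ is the normal form (a finite set) of $s$. Taylor approximation $\ltimes$ is inductive: $x\ltimes x$; $s\ltimes M\Rightarrow\lambda x.s\ltimes\lambda x.M$; ($s\ltimes M$ and $t_i\ltimes N$ for all $i$) $\Rightarrow\langle s\rangle[t_1,\dots,t_n]\ltimes(M)N$; no resource term approximates $\bot$; $\mathcal T(M)=\{s : s\ltimes M\}$. *)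

theory Defs
  imports Main "HOL-Library.Multiset"
begin

section \<open>Possibly infinite lambda-terms (de Bruijn indices, so alpha-equivalence is equality)\<close>

codatatype lterm = LVar nat | LBot | LLam lterm | LApp lterm lterm

inductive subterm :: "lterm \<Rightarrow> lterm \<Rightarrow> bool" where
  st_refl: "subterm M M"
| st_lam: "subterm N P \<Longrightarrow> subterm N (LLam P)"
| st_fun: "subterm N P \<Longrightarrow> subterm N (LApp P Q)"
| st_arg: "subterm N Q \<Longrightarrow> subterm N (LApp P Q)"

inductive spine_fin :: "lterm \<Rightarrow> bool" where
  "spine_fin (LVar x)"
| "spine_fin LBot"
| "spine_fin P \<Longrightarrow> spine_fin (LLam P)"
| "spine_fin P \<Longrightarrow> spine_fin (LApp P Q)"

text \<open>Lambda_bot^001: every infinite branch enters an argument position infinitely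
  often, i.e. from every node, the non-argument path is finite.\<close>
definition is001 :: "lterm \<Rightarrow> bool" where
  "is001 M \<longleftrightarrow> (\<forall>N. subterm N M \<longrightarrow> spine_fin N)"

definition Lambda001 :: "lterm set" where
  "Lambda001 = {M. is001 M \<and> (\<forall>N. subterm N M \<longrightarrow> N \<noteq> LBot)}"

primcorec lift :: "nat \<Rightarrow> lterm \<Rightarrow> lterm" where
  "lift k M = (case M of
      LVar i \<Rightarrow> LVar (if i < k then i else Suc i)
    | LBot \<Rightarrow> LBot
    | LLam P \<Rightarrow> LLam (lift (Suc k) P)
    | LApp P Q \<Rightarrow> LApp (lift k P) (lift k Q))"

text \<open>\<open>subst k N M\<close>: substitute \<open>N\<close> (already lifted to depth \<open>k\<close>) for index \<open>k\<close>
  in \<open>M\<close>, decrementing the indices above \<open>k\<close> (the binder disappears).\<close>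
primcorec subst :: "nat \<Rightarrow> lterm \<Rightarrow> lterm \<Rightarrow> lterm" where
  "subst k N M = (case M of
      LVar i \<Rightarrow> (if i = k then N else LVar (if i < k then i else i - 1))
    | LBot \<Rightarrow> LBot
    | LLam P \<Rightarrow> LLam (subst (Suc k) (lift 0 N) P)
    | LApp P Q \<Rightarrow> LApp (subst k N P) (subst k N Q))"

definition beta_contract :: "lterm \<Rightarrow> lterm \<Rightarrow> lterm" where
  "beta_contract P Q = subst 0 Q P"

inductive beta :: "lterm \<Rightarrow> lterm \<Rightarrow> bool" where
  beta_redex: "beta (LApp (LLam P) Q) (beta_contract P Q)"
| beta_lam: "beta P P' \<Longrightarrow> beta (LLam P) (LLam P')"
| beta_fun: "beta P P' \<Longrightarrow> beta (LApp P Q) (LApp P' Q)"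
| beta_arg: "beta Q Q' \<Longrightarrow> beta (LApp P Q) (LApp P Q')"

abbreviation beta_star :: "lterm \<Rightarrow> lterm \<Rightarrow> bool" where
  "beta_star \<equiv> beta\<^sup>*\<^sup>*"

text \<open>Infinitary beta-reduction: the rules (var), (lambda), (@), inductive in the
  first two kinds of premises and coinductive in the argument premise of (@),
  so that every infinite derivation branch crosses the argument premise of (@)
  infinitely often.\<close>
inductive binf_step :: "(lterm \<Rightarrow> lterm \<Rightarrow> bool) \<Rightarrow> lterm \<Rightarrow> lterm \<Rightarrow> bool"
  for R :: "lterm \<Rightarrow> lterm \<Rightarrow> bool" where
  binf_var: "beta_star M (LVar x) \<Longrightarrow> binf_step R M (LVar x)"
| binf_lam: "beta_star M (LLam P) \<Longrightarrow> binf_step R P P' \<Longrightarrow> binf_step R M (LLam P')"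
| binf_app: "beta_star M (LApp P Q) \<Longrightarrow> binf_step R P P' \<Longrightarrow> R Q Q'
             \<Longrightarrow> binf_step R M (LApp P' Q')"

lemma binf_step_mono: "R \<le> S \<Longrightarrow> binf_step R \<le> binf_step S"
proof (intro le_funI le_boolI)
  fix M N assume RS: "R \<le> S"
  assume "binf_step R M N"
  then show "binf_step S M N"
    by (induction rule: binf_step.induct) (use RS in \<open>auto intro: binf_step.intros\<close>)
qed

coinductive beta_inf :: "lterm \<Rightarrow> lterm \<Rightarrow> bool" where
  "binf_step beta_inf M N \<Longrightarrow> beta_inf M N"
  monos binf_step_mono

text \<open>Abstraction \<open>\<lambda>x_j. M\<close> over the free variable (named) \<open>j\<close>; the other free
  variables keep their names.  \<open>abs_ren j d\<close> works at binder depth \<open>d\<close>.\<close>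
primcorec abs_ren :: "nat \<Rightarrow> nat \<Rightarrow> lterm \<Rightarrow> lterm" where
  "abs_ren j d M = (case M of
      LVar i \<Rightarrow> LVar (if i < d then i else if i - d = j then d else Suc i)
    | LBot \<Rightarrow> LBot
    | LLam P \<Rightarrow> LLam (abs_ren j (Suc d) P)
    | LApp P Q \<Rightarrow> LApp (abs_ren j d P) (abs_ren j d Q))"

definition abs_var :: "nat \<Rightarrow> lterm \<Rightarrow> lterm" where
  "abs_var j M = LLam (abs_ren j 0 M)"

definition apps :: "lterm \<Rightarrow> lterm list \<Rightarrow> lterm" where
  "apps H Ns = foldl LApp H Ns"

definition lams :: "nat \<Rightarrow> lterm \<Rightarrow> lterm" where
  "lams m P = (LLam ^^ m) P"

definition solvable :: "lterm \<Rightarrow> bool" where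
  "solvable M \<longleftrightarrow> (\<exists>xs Ns. set Ns \<subseteq> Lambda001 \<and>
      beta_inf (apps (foldr abs_var xs M) Ns) (LLam (LVar 0)))"

inductive hred :: "lterm \<Rightarrow> lterm \<Rightarrow> bool" where
  hred_redex: "hred (LApp (LLam P) Q) (beta_contract P Q)"
| hred_lam: "hred P P' \<Longrightarrow> hred (LLam P) (LLam P')"
| hred_app: "hred P P' \<Longrightarrow> \<not> is_LLam P \<Longrightarrow> hred (LApp P Q) (LApp P' Q)"

datatype bstate = is_BBot: BBot | BLams (bl_m: nat) (bl_y: nat) (bl_args: "lterm list")

text \<open>Head normal form data \<open>(m, y, [M_1..M_n])\<close> with
  \<open>M \<rightarrow>h* \<lambda>x_1..x_m. y M_1 .. M_n\<close> (arguments stored reversed in the state).\<close>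
definition bt_start :: "lterm \<Rightarrow> bstate" where
  "bt_start M = (if solvable M then
      (case (SOME (m, y, Ns). hred\<^sup>*\<^sup>* M (lams m (apps (LVar y) Ns))) of
         (m, y, Ns) \<Rightarrow> BLams m y (rev Ns))
    else BBot)"

primcorec bt_aux :: "bstate \<Rightarrow> lterm" where
  "bt_aux s = (if is_BBot s then LBot
     else if bl_m s > 0 then LLam (bt_aux (BLams (bl_m s - 1) (bl_y s) (bl_args s)))
     else if bl_args s = [] then LVar (bl_y s)
     else LApp (bt_aux (BLams 0 (bl_y s) (tl (bl_args s)))) (bt_aux (bt_start (hd (bl_args s)))))"

definition BT :: "lterm \<Rightarrow> lterm" where
  "BT M = bt_aux (bt_start M)"

datatype rterm = RVar nat | RLam rterm | RApp rterm "rterm multiset"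

primrec rlift :: "nat \<Rightarrow> rterm \<Rightarrow> rterm" where
  "rlift k (RVar i) = RVar (if i < k then i else Suc i)"
| "rlift k (RLam s) = RLam (rlift (Suc k) s)"
| "rlift k (RApp s U) = RApp (rlift k s) (image_mset (rlift k) U)"

text \<open>Linear substitution: \<open>lsub x s T s'\<close> holds iff \<open>s'\<close> is obtained from \<open>s\<close> by
  replacing the free occurrences of index \<open>x\<close> bijectively by the elements of the
  bag \<open>T\<close> (lifted under binders); the bound indices above \<open>x\<close> are decremented.
  The set of such \<open>s'\<close> is the finite sum \<open>s\<langle>T/x\<rangle>\<close> (empty if the number of
  occurrences differs from the size of \<open>T\<close>).\<close>
inductive lsub :: "nat \<Rightarrow> rterm \<Rightarrow> rterm multiset \<Rightarrow> rterm \<Rightarrow> bool"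
  and lsub_bag :: "nat \<Rightarrow> rterm multiset \<Rightarrow> rterm multiset \<Rightarrow> rterm multiset \<Rightarrow> bool" where
  ls_hit: "lsub x (RVar x) {#t#} t"
| ls_miss: "y \<noteq> x \<Longrightarrow> lsub x (RVar y) {#} (RVar (if y < x then y else y - 1))"
| ls_lam: "lsub (Suc x) s (image_mset (rlift 0) T) s' \<Longrightarrow> lsub x (RLam s) T (RLam s')"
| ls_app: "lsub x s T0 s' \<Longrightarrow> lsub_bag x U T1 U' \<Longrightarrow> lsub x (RApp s U) (T0 + T1) (RApp s' U')"
| lb_empty: "lsub_bag x {#} {#} {#}"
| lb_add: "lsub x u T0 u' \<Longrightarrow> lsub_bag x U T1 U' \<Longrightarrow>
           lsub_bag x (add_mset u U) (T0 + T1) (add_mset u' U')"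

definition lin_subst :: "rterm \<Rightarrow> rterm multiset \<Rightarrow> rterm set" where
  "lin_subst s T = {s'. lsub 0 s T s'}"

text \<open>One-step resource reduction of a resource term to a finite sum (a finite set).\<close>
inductive rstep :: "rterm \<Rightarrow> rterm set \<Rightarrow> bool" where
  rs_redex: "rstep (RApp (RLam s) T) (lin_subst s T)"
| rs_lam: "rstep s S \<Longrightarrow> rstep (RLam s) (RLam ` S)"
| rs_fun: "rstep s S \<Longrightarrow> rstep (RApp s U) ((\<lambda>s'. RApp s' U) ` S)"
| rs_arg: "rstep u S \<Longrightarrow> rstep (RApp s (add_mset u U)) ((\<lambda>u'. RApp s (add_mset u' U)) ` S)"

definition rsum_step :: "rterm set \<Rightarrow> rterm set \<Rightarrow> bool" where
  "rsum_step S S' \<longleftrightarrow> (\<exists>ss Ts. set ss = S \<and> length Ts = length ss \<and>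
      (\<forall>i < length ss. rstep (ss ! i) (Ts ! i) \<or> Ts ! i = {ss ! i}) \<and>
      (\<exists>i < length ss. rstep (ss ! i) (Ts ! i)) \<and>
      S' = \<Union> (set Ts))"

definition rnormal :: "rterm set \<Rightarrow> bool" where
  "rnormal S \<longleftrightarrow> \<not> (\<exists>S'. rsum_step S S')"

definition nf_r :: "rterm \<Rightarrow> rterm set" where
  "nf_r s = (THE S. rsum_step\<^sup>*\<^sup>* {s} S \<and> rnormal S)"

definition NF_r :: "rterm set \<Rightarrow> rterm set" where
  "NF_r SS = (\<Union>s\<in>SS. nf_r s)"

inductive taylor_approx :: "rterm \<Rightarrow> lterm \<Rightarrow> bool" where
  ta_var: "taylor_approx (RVar x) (LVar x)"
| ta_lam: "taylor_approx s M \<Longrightarrow> taylor_approx (RLam s) (LLam M)"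
| ta_app: "taylor_approx s M \<Longrightarrow> (\<forall>t\<in>#T. taylor_approx t N) \<Longrightarrow>
           taylor_approx (RApp s T) (LApp M N)"

definition Taylor :: "lterm \<Rightarrow> rterm set" where
  "Taylor M = {s. taylor_approx s M}"

end

theory Submission
  imports Defs
begin

text \<open>
  Reading a sum elementwise, \<open>rred s s'\<close> says that \<open>s'\<close> occurs in a one-step reduct of \<open>s\<close>.
  Resource reduction is locally confluent and strictly decreases the size, so by Newman's argument
  the normal form of \<open>s\<close> is the set \<open>Nf s\<close> of normal terms that \<open>rred\<close> reaches from \<open>s\<close>, and it
  does not depend on the strategy. Head reduction of \<open>M\<close> is simulated by its approximants, and
  every approximant of a beta-reduct of \<open>M\<close> is reached from an approximant of \<open>M\<close>. Hence
  \<open>NF_r (Taylor M)\<close> is invariant under head reduction and empty if \<open>M\<close> has no head normal form. On a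
  head normal form it is computed componentwise, as is the Taylor expansion of the Boehm tree, and
  the two sets agree by induction on the size of their elements. Solvable terms have a head normal
  form because beta-reduction never enlarges \<open>NF_r (Taylor M)\<close>, and an application has an empty one
  as soon as its function part has.
\<close>

section \<open>Linear substitution and lifting\<close>

text \<open>A resource step yields several terms or none, so two terms reached from the same one
  need not have a common reduct. Confluence is therefore stated by comparing one element of a sum
  with the whole of the other sum. Its critical pairs rest on a substitution lemma: a bag
  substituted into the result of another substitution splits into the part that enters the original
  term and the part that enters the inserted elements.

  Approximants are finite, whereas \<open>M\<close> and its Boehm tree may be infinite, so the
  inductions run on resource terms: the size of an approximant bounds the head steps it can follow,
  and the elements of its bags are smaller than it. Coinduction remains only for the commutation of
  renaming with lifting and substitution. The infinitary reduction in the definition of solvability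
  becomes finite because its target \<lambda>x.x contains no application. The head normal form in
  the Boehm tree is picked by \<open>SOME\<close>; every pick gives the same set of normal forms,
  because head reduction preserves that set.\<close>

inductive_cases lsub_RVarE: "lsub x (RVar y) T s'"
inductive_cases lsub_RLamE: "lsub x (RLam s) T s'"
inductive_cases lsub_RAppE: "lsub x (RApp s U) T s'"
inductive_cases lsub_bag_emptyE: "lsub_bag x {#} T V"

lemma rlift_rlift: "j \<le> k \<Longrightarrow> rlift (Suc k) (rlift j s) = rlift j (rlift k s)"
proof (induction s arbitrary: j k)
  case (RApp s U)
  then show ?case by (auto simp: multiset.map_comp intro!: image_mset_cong)
qed simp_all

text \<open>A bag has no first element, while a derivation by \<open>lb_add\<close> treats its
  elements in some order. Any chosen element can be made the last one added, because the
  contributions to \<open>T\<close> and \<open>V\<close> are summed commutatively. This gives an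
  inversion rule for every presentation of the bag.\<close>

lemma lsub_bag_add_remove:
  "lsub_bag x W T V \<Longrightarrow> u \<in># W \<Longrightarrow>
   \<exists>T0 T1 u' V'. T = T0 + T1 \<and> V = add_mset u' V' \<and> lsub x u T0 u' \<and> lsub_bag x (W - {#u#}) T1 V'"
proof (induction rule: lsub_lsub_bag.inducts(2)[where ?P1.0="\<lambda>_ _ _ _. True"])
  case (lb_add x w T0 w' U T1 U')
  show ?case
  proof (cases "u = w")
    case True
    then show ?thesis using lb_add(1,3)
      by - (rule exI[of _ T0], rule exI[of _ T1], rule exI[of _ w'], rule exI[of _ U'], simp)
  next
    case False
    then have "u \<in># U" using lb_add.prems by simp
    from lb_add.IH[OF this] obtain A B u' V' where *: "T1 = A + B" "U' = add_mset u' V'" "lsub x u A u'"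
      "lsub_bag x (U - {#u#}) B V'" by blast
    have "lsub_bag x (add_mset w U - {#u#}) (T0 + B) (add_mset w' V')"
      using lsub_lsub_bag.lb_add[OF lb_add(1) *(4)] False
        by simp
    moreover have "T0 + T1 = A + (T0 + B)" using * by simp
    moreover have "add_mset w' U' = add_mset u' (add_mset w' V')" using * by simp
    ultimately show ?thesis using *(3)
      by - (rule exI[of _ A], rule exI[of _ "T0 + B"], rule exI[of _ u'], rule exI[of _ "add_mset w' V'"], simp only: simp_thms)
  qed
qed simp_all

lemma lsub_bag_addE:
  assumes "lsub_bag x (add_mset u U) T V"
  obtains T0 T1 u' V' where "T = T0 + T1" "V = add_mset u' V'" "lsub x u T0 u'" "lsub_bag x U T1 V'"
  using lsub_bag_add_remove[OF assms, of u] by auto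

text \<open>The same rearrangement, directed by an element of the result. It serves when the result
  bag is itself consumed, and split, by a further substitution.\<close>

lemma lsub_bag_add_removeR:
  "lsub_bag x W T V \<Longrightarrow> u' \<in># V \<Longrightarrow>
   \<exists>T0 T1 u W'. T = T0 + T1 \<and> W = add_mset u W' \<and> lsub x u T0 u' \<and> lsub_bag x W' T1 (V - {#u'#})"
proof (induction rule: lsub_lsub_bag.inducts(2)[where ?P1.0="\<lambda>_ _ _ _. True"])
  case (lb_add x w T0 w' U T1 U')
  show ?case
  proof (cases "u' = w'")
    case True
    then show ?thesis using lb_add(1,3)
      by - (rule exI[of _ T0], rule exI[of _ T1], rule exI[of _ w], rule exI[of _ U], simp)
  next
    case False
    then have "u' \<in># U'" using lb_add.prems by simp
    from lb_add.IH[OF this] obtain A B u V' where *: "T1 = A + B" "U = add_mset u V'" "lsub x u A u'"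
      "lsub_bag x V' B (U' - {#u'#})" by blast
    have "lsub_bag x (add_mset w V') (T0 + B) (add_mset w' U' - {#u'#})"
      using lsub_lsub_bag.lb_add[OF lb_add(1) *(4)] False
        by simp
    moreover have "T0 + T1 = A + (T0 + B)" using * by simp
    moreover have "add_mset w U = add_mset u (add_mset w V')" using * by simp
    ultimately show ?thesis using *(3)
      by - (rule exI[of _ A], rule exI[of _ "T0 + B"], rule exI[of _ u], rule exI[of _ "add_mset w V'"], simp only: simp_thms)
  qed
qed simp_all

lemma lsub_bag_addRE:
  assumes "lsub_bag x W T (add_mset u' V)"
  obtains T0 T1 u U where "T = T0 + T1" "W = add_mset u U" "lsub x u T0 u'" "lsub_bag x U T1 V"
  using lsub_bag_add_removeR[OF assms, of u'] by auto

lemma lsub_bag_emptyR: "lsub_bag x W T {#} \<Longrightarrow> W = {#} \<and> T = {#}"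
  by (erule lsub_bag.cases) auto

lemma lsub_bag_unionR:
  "lsub_bag x W T (V1 + V2) \<Longrightarrow>
   \<exists>W1 W2 T1 T2. W = W1 + W2 \<and> T = T1 + T2 \<and> lsub_bag x W1 T1 V1 \<and> lsub_bag x W2 T2 V2"
proof (induction V1 arbitrary: W T)
  case empty
  then show ?case using lb_empty by force
next
  case (add v V1)
  then obtain T0 T1 u U where *: "T = T0 + T1" "W = add_mset u U" "lsub x u T0 v" "lsub_bag x U T1 (V1+V2)"
    by (auto elim: lsub_bag_addRE)
  from add.IH[OF *(4)] obtain W1 W2 A B where
    "U = W1 + W2 \<and> T1 = A + B \<and> lsub_bag x W1 A V1 \<and> lsub_bag x W2 B V2" by blast
  then show ?case using * lb_add[OF *(3)]
    by (metis add.assoc union_mset_add_mset_left)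
qed

lemma lsub_bag_union:
  "lsub_bag x U1 T1 V1 \<Longrightarrow> lsub_bag x U2 T2 V2 \<Longrightarrow> lsub_bag x (U1 + U2) (T1 + T2) (V1 + V2)"
proof (induction rule: lsub_lsub_bag.inducts(2)[where ?P1.0="\<lambda>_ _ _ _. True"])
  case (lb_add x u T0 u' U T1 U')
  then show ?case using lsub_lsub_bag.lb_add[OF lb_add(1)] by (simp add: add.assoc)
qed auto

lemma lsub_bag_single: "lsub_bag x {#u#} T {#v#} \<longleftrightarrow> lsub x u T v"
proof
  assume "lsub_bag x {#u#} T {#v#}"
  then show "lsub x u T v" by (auto elim!: lsub_bag_addE lsub_bag_emptyE)
next
  assume "lsub x u T v"
  from lb_add[OF this lb_empty] show "lsub_bag x {#u#} T {#v#}" by simp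
qed

text \<open>
  The two ways in which lifting \<open>s\<langle>T/x\<rangle>\<close> at \<open>k\<close> is distributed over the substitution: it becomes
  \<open>s\<langle>T/x'\<rangle>\<close> with \<open>s\<close> lifted at \<open>k'\<close> and \<open>T\<close> lifted at \<open>k\<close>. For \<open>k = x\<close> both are possible.
\<close>
definition lift_shift :: "nat \<Rightarrow> nat \<Rightarrow> nat \<Rightarrow> nat \<Rightarrow> bool" where
  "lift_shift k x k' x' \<longleftrightarrow> (k \<le> x \<and> x' = Suc x \<and> k' = k) \<or> (x \<le> k \<and> x' = x \<and> k' = Suc k)"

lemma lift_shift_Suc: "lift_shift k x k' x' \<Longrightarrow> lift_shift (Suc k) (Suc x) (Suc k') (Suc x')"
  by (auto simp: lift_shift_def)

lemma image_rlift_rlift0: "image_mset (rlift (Suc k)) (image_mset (rlift 0) T) =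
    image_mset (rlift 0) (image_mset (rlift k) T)"
  by (simp add: multiset.map_comp comp_def rlift_rlift)

lemma singleton_eq_image_mset: "{#t#} = image_mset f T \<Longrightarrow> \<exists>u. T = {#u#} \<and> t = f u"
  by (cases T) auto

lemma lsub_rlift:
  "lsub x s T s' \<Longrightarrow> lift_shift k x k' x' \<Longrightarrow>
    lsub x' (rlift k' s) (image_mset (rlift k) T) (rlift k s')"
  "lsub_bag x U T U' \<Longrightarrow> lift_shift k x k' x' \<Longrightarrow>
    lsub_bag x' (image_mset (rlift k') U) (image_mset (rlift k) T) (image_mset (rlift k) U')"
proof (induction x s T s' and x U T U' arbitrary: k k' x' and k k' x' rule: lsub_lsub_bag.inducts)
  case (ls_hit x t)
  then have "rlift k' (RVar x) = RVar x'" by (auto simp: lift_shift_def)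
  then show ?case using lsub_lsub_bag.ls_hit by simp
next
  case (ls_miss y x)
  have "rlift k' (RVar y) = RVar (if y < k' then y else Suc y)" by simp
  moreover have "(if y < k' then y else Suc y) \<noteq> x'"
    using ls_miss by (auto simp: lift_shift_def)
  moreover have "rlift k (RVar (if y < x then y else y - 1)) = 
     RVar (let z = if y < k' then y else Suc y in if z < x' then z else z - 1)"
    using ls_miss by (auto simp: lift_shift_def)
  ultimately show ?case using lsub_lsub_bag.ls_miss[of "if y < k' then y else Suc y" x']
    by (simp add: Let_def del: rlift.simps)
next
  case (ls_lam x s T s')
  from ls_lam.IH[OF lift_shift_Suc[OF ls_lam.prems]]
  show ?case by (auto simp: image_rlift_rlift0 intro: lsub_lsub_bag.ls_lam)
qed (auto intro: lsub_lsub_bag.intros)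

text \<open>With \<open>lsub_rlift\<close>, the results of the lifted substitution are exactly the
  lifts of the original results, as an equality of sums requires. The lifted data are given by
  equations so that the induction can follow the lifted derivation.\<close>

lemma lsub_rlift_inv:
  "lsub x' S TT s'' \<Longrightarrow> S = rlift k' s \<Longrightarrow> TT = image_mset (rlift k) T \<Longrightarrow> lift_shift k x k' x' \<Longrightarrow>
    \<exists>s'. s'' = rlift k s' \<and> lsub x s T s'"
  "lsub_bag x' UU TT U'' \<Longrightarrow> UU = image_mset (rlift k') U \<Longrightarrow> TT = image_mset (rlift k) T \<Longrightarrow>
    lift_shift k x k' x' \<Longrightarrow> \<exists>U'. U'' = image_mset (rlift k) U' \<and> lsub_bag x U T U'"
proof (induction x' S TT s'' and x' UU TT U'' arbitrary: k k' x s T and k k' x U T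
    rule: lsub_lsub_bag.inducts)
  case (ls_hit x' t)
  then obtain i where s: "s = RVar i" by (cases s) auto
  have "i = x" using ls_hit s by (auto simp: lift_shift_def split: if_splits)
  obtain u where "T = {#u#}" "t = rlift k u" using ls_hit.prems(2) singleton_eq_image_mset by metis
  then show ?case using s \<open>i = x\<close> by (auto intro: lsub_lsub_bag.ls_hit)
next
  case (ls_miss y x')
  then obtain i where s: "s = RVar i" by (cases s) auto
  have "i \<noteq> x" "RVar (if y < x' then y else y - 1) = rlift k (RVar (if i < x then i else i - 1))"
    using ls_miss s by (auto simp: lift_shift_def split: if_splits)
  moreover have "T = {#}" using ls_miss by simp
  ultimately show ?case using s lsub_lsub_bag.ls_miss by metis
next
  case (ls_lam x' S TT s'')
  then obtain s1 where s: "s = RLam s1" "S = rlift (Suc k') s1" by (cases s) auto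
  from ls_lam.IH[OF s(2) _ lift_shift_Suc[OF ls_lam.prems(3)], of "image_mset (rlift 0) T"]
  obtain s' where "s'' = rlift (Suc k) s'" "lsub (Suc x) s1 (image_mset (rlift 0) T) s'"
    using ls_lam.prems by (auto simp: image_rlift_rlift0)
  then show ?case using s by (auto intro!: exI[of _ "RLam s'"] lsub_lsub_bag.ls_lam)
next
  case (ls_app x' S0 T0 s'' UU T1 U'')
  then obtain s1 U1 where s: "s = RApp s1 U1" "S0 = rlift k' s1" "UU = image_mset (rlift k') U1"
    by (cases s) auto
  obtain A B where T: "T = A + B" "T0 = image_mset (rlift k) A" "T1 = image_mset (rlift k) B"
    using ls_app.prems(2) image_mset_eq_plusD by metis
  show ?case using ls_app.IH(1)[OF s(2) T(2) ls_app.prems(3)] ls_app.IH(2)[OF s(3) T(3) ls_app.prems(3)]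
    s T by (metis lsub_lsub_bag.ls_app rlift.simps(3))
next
  case (lb_empty x')
  then show ?case by (auto intro: lsub_lsub_bag.lb_empty)
next
  case (lb_add x' u T0 u' UU T1 U'')
  from lb_add.prems(1) obtain w W where U: "U = add_mset w W" "u = rlift k' w" "UU = image_mset (rlift k') W"
    by (metis msed_map_invR)
  obtain A B where T: "T = A + B" "T0 = image_mset (rlift k) A" "T1 = image_mset (rlift k) B"
    using lb_add.prems(2) image_mset_eq_plusD by metis
  show ?case using lb_add.IH(1)[OF U(2) T(2) lb_add.prems(3)] lb_add.IH(2)[OF U(3) T(3) lb_add.prems(3)]
    U T by (metis lsub_lsub_bag.lb_add image_mset_add_mset)
qed

lemma lsub_fresh: "lsub k (rlift k s) {#} s"
proof (induction s arbitrary: k)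
  case (RVar i)
  then show ?case using ls_miss[of "if i < k then i else Suc i" k] by (auto split: if_splits)
next
  case (RLam s)
  then show ?case by (auto intro: ls_lam)
next
  case (RApp s U)
  have "lsub_bag k (image_mset (rlift k) U) {#} U"
    using RApp(2)
  proof (induction U)
    case empty then show ?case by (auto intro: lb_empty)
  next
    case (add u U)
    then show ?case using lb_add[of k "rlift k u" "{#}" u "image_mset (rlift k) U" "{#}" U] by auto
  qed
  then show ?case using ls_app[of k "rlift k s" "{#}" s] RApp(1) by auto
qed

text \<open>Index \<open>k\<close> does not occur in \<open>rlift k s\<close>: no position is open
  to an element of the bag, and the decrement undoes the lifting.\<close>

lemma lsub_fresh_inv:
  "lsub k S T s' \<Longrightarrow> S = rlift k s \<Longrightarrow> T = {#} \<and> s' = s"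
  "lsub_bag k UU T U' \<Longrightarrow> UU = image_mset (rlift k) U \<Longrightarrow> T = {#} \<and> U' = U"
proof (induction k S T s' and k UU T U' arbitrary: s and U rule: lsub_lsub_bag.inducts)
  case (ls_hit x t)
  then show ?case by (cases s) (auto split: if_splits)
next
  case (ls_miss y x)
  then show ?case by (cases s) (auto split: if_splits)
next
  case (ls_lam x S T s')
  then show ?case by (cases s) auto
next
  case (ls_app x S T0 s' U T1 U')
  then show ?case by (cases s) auto
next
  case (lb_empty x)
  then show ?case by auto
next
  case (lb_add x u T0 u' UU T1 U')
  from lb_add.prems(1) obtain w W where U: "U = add_mset w W" "u = rlift x w" "UU = image_mset (rlift x) W"
    by (metis msed_map_invR)
  then show ?case using lb_add.IH by auto
qed

section \<open>Linear substitution commutes with itself and with reduction\<close>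

text \<open>The substitution lemma, read as a splitting of resources: each element of
  \<open>B\<close> replaces an occurrence that was already in \<open>q\<close> or one that came with
  \<open>D\<close>. Index \<open>x\<close> is \<open>Suc x\<close> in \<open>q\<close>, where the
  variable \<open>k\<close> is still present, and for the same reason \<open>B0\<close> is lifted at
  \<open>k\<close>.\<close>

lemma lsub_commute_fwd:
  "lsub k q D p \<Longrightarrow> k \<le> x \<Longrightarrow> lsub x p B r \<Longrightarrow>
    \<exists>B0 B1 q' D'. B = B0 + B1 \<and> lsub (Suc x) q (image_mset (rlift k) B0) q' \<and>
      lsub_bag x D B1 D' \<and> lsub k q' D' r"
  "lsub_bag k U D P \<Longrightarrow> k \<le> x \<Longrightarrow> lsub_bag x P B V \<Longrightarrow>
    \<exists>B0 B1 U' D'. B = B0 + B1 \<and> lsub_bag (Suc x) U (image_mset (rlift k) B0) U' \<and>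
      lsub_bag x D B1 D' \<and> lsub_bag k U' D' V"
proof (induction k q D p and k U D P arbitrary: x B r and x B V rule: lsub_lsub_bag.inducts)
  case (ls_hit k t)
  have "lsub (Suc x) (RVar k) {#} (RVar k)"
    using ls_miss[of k "Suc x"] ls_hit by auto
  moreover have "lsub k (RVar k) {#r#} r" by (rule lsub_lsub_bag.ls_hit)
  ultimately show ?case using ls_hit lsub_bag_single[of x t B r] 
    by - (rule exI[of _ "{#}"], rule exI[of _ B], rule exI[of _ "RVar k"], rule exI[of _ "{#r#}"], auto)
next
  case (ls_miss y k)
  show ?case
  proof (cases "y = Suc x")
    \<comment> \<open>The variable is the outer one. It receives the lifted \<open>r\<close>, and
      substituting the empty bag for \<open>k\<close> afterwards removes the lifting by
      \<open>lsub_fresh\<close>.\<close>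
    case True
    then have "B = {#r#}" using ls_miss by (auto elim: lsub_RVarE)
    moreover have "lsub (Suc x) (RVar y) {#rlift k r#} (rlift k r)"
      using True lsub_lsub_bag.ls_hit by simp
    ultimately show ?thesis using lsub_fresh[of k r]
      by - (rule exI[of _ B], rule exI[of _ "{#}"], rule exI[of _ "rlift k r"], rule exI[of _ "{#}"], auto intro: lb_empty)
  next
    case False
    let ?y = "if y < k then y else y - 1"
    have ne: "?y \<noteq> x" using False ls_miss by auto
    have B: "B = {#}" "r = RVar (if ?y < x then ?y else ?y - 1)"
      using ne ls_miss(3) by (auto elim: lsub_RVarE)
    let ?z = "if y < Suc x then y else y - 1"
    have "lsub (Suc x) (RVar y) {#} (RVar ?z)" using False by (rule lsub_lsub_bag.ls_miss)
    moreover have "?z \<noteq> k" using ls_miss False by auto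
    from lsub_lsub_bag.ls_miss[OF this] have "lsub k (RVar ?z) {#} r"
      using B ls_miss(1,2) False by (auto split: if_splits)
    ultimately show ?thesis using B
      by - (rule exI[of _ "{#}"], rule exI[of _ "{#}"], rule exI[of _ "RVar ?z"], rule exI[of _ "{#}"], auto intro: lb_empty)
  qed
next
  case (ls_lam k q D p)
  from ls_lam.prems(2) obtain r1 where r: "r = RLam r1" "lsub (Suc x) p (image_mset (rlift 0) B) r1"
    by (auto elim: lsub_RLamE)
  from ls_lam.IH[OF _ r(2)] ls_lam.prems(1) obtain B0' B1' q' D'' where
    *: "image_mset (rlift 0) B = B0' + B1'" "lsub (Suc (Suc x)) q (image_mset (rlift (Suc k)) B0') q'"
       "lsub_bag (Suc x) (image_mset (rlift 0) D) B1' D''" "lsub (Suc k) q' D'' r1" by auto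
  from *(1) obtain B0 B1 where B: "B = B0 + B1" "B0' = image_mset (rlift 0) B0" "B1' = image_mset (rlift 0) B1"
    using image_mset_eq_plusD by metis
  \<comment> \<open>The bag from the induction hypothesis lives under the binder; inverting the
    lifting yields the corresponding bag outside.\<close>
  from lsub_rlift_inv(2)[OF *(3) refl B(3), of x] obtain D' where
    D: "D'' = image_mset (rlift 0) D'" "lsub_bag x D B1 D'" by (auto simp: lift_shift_def)
  have "lsub (Suc x) (RLam q) (image_mset (rlift k) B0) (RLam q')"
    using *(2) B(2) by (auto intro!: lsub_lsub_bag.ls_lam simp: image_rlift_rlift0)
  moreover have "lsub k (RLam q') D' r" using *(4) D r by (auto intro: lsub_lsub_bag.ls_lam)
  ultimately show ?case using B D by blast
next
  case (ls_app k q D0 p U D1 P)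
  from ls_app.prems(2) obtain A0 A1 r1 V where
    a: "B = A0 + A1" "r = RApp r1 V" "lsub x p A0 r1" "lsub_bag x P A1 V" by (auto elim: lsub_RAppE)
  from ls_app.IH(1)[OF ls_app.prems(1) a(3)] obtain B0 B1 q' D' where
    b: "A0 = B0 + B1" "lsub (Suc x) q (image_mset (rlift k) B0) q'" "lsub_bag x D0 B1 D'" "lsub k q' D' r1"
    by blast
  from ls_app.IH(2)[OF ls_app.prems(1) a(4)] obtain C0 C1 U' E' where
    c: "A1 = C0 + C1" "lsub_bag (Suc x) U (image_mset (rlift k) C0) U'" "lsub_bag x D1 C1 E'"
       "lsub_bag k U' E' V" by blast
  have "lsub (Suc x) (RApp q U) (image_mset (rlift k) (B0 + C0)) (RApp q' U')"
    using lsub_lsub_bag.ls_app[OF b(2) c(2)] by simp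
  moreover have "lsub_bag x (D0 + D1) (B1 + C1) (D' + E')" using b c lsub_bag_union by blast
  moreover have "lsub k (RApp q' U') (D' + E') r" using b c a lsub_lsub_bag.ls_app by blast
  moreover have "B = (B0 + C0) + (B1 + C1)" using a b c by (simp add: ac_simps)
  ultimately show ?case by blast
next
  case (lb_empty k)
  then have "B = {#}" "V = {#}" by (auto elim!: lsub_bag_emptyE)
  moreover have "{#} = {#} + {#}" "image_mset (rlift k) {#} = {#}" by simp_all
  ultimately show ?case using lsub_lsub_bag.lb_empty by metis
next
  case (lb_add k q D0 p U D1 P)
  from lb_add.prems(2) obtain A0 A1 r1 V' where
    a: "B = A0 + A1" "V = add_mset r1 V'" "lsub x p A0 r1" "lsub_bag x P A1 V'" by (rule lsub_bag_addE)
  from lb_add.IH(1)[OF lb_add.prems(1) a(3)] obtain B0 B1 q' D' where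
    b: "A0 = B0 + B1" "lsub (Suc x) q (image_mset (rlift k) B0) q'" "lsub_bag x D0 B1 D'" "lsub k q' D' r1"
    by blast
  from lb_add.IH(2)[OF lb_add.prems(1) a(4)] obtain C0 C1 U' E' where
    c: "A1 = C0 + C1" "lsub_bag (Suc x) U (image_mset (rlift k) C0) U'" "lsub_bag x D1 C1 E'"
       "lsub_bag k U' E' V'" by blast
  have "lsub_bag (Suc x) (add_mset q U) (image_mset (rlift k) (B0 + C0)) (add_mset q' U')"
    using lsub_lsub_bag.lb_add[OF b(2) c(2)] by simp
  moreover have "lsub_bag x (D0 + D1) (B1 + C1) (D' + E')" using b c lsub_bag_union by blast
  moreover have "lsub_bag k (add_mset q' U') (D' + E') V" using b c a lsub_lsub_bag.lb_add by blast
  moreover have "B = (B0 + C0) + (B1 + C1)" using a b c by (simp add: ac_simps)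
  ultimately show ?case by blast
qed

text \<open>The converse reassembles the two parts of \<open>B\<close>. The induction follows the
  derivation for \<open>q\<close>, whose shifted index and lifted bag are kept as equations.\<close>

lemma lsub_commute_bwd:
  "lsub x' q T q' \<Longrightarrow> x' = Suc x \<Longrightarrow> T = image_mset (rlift k) B0 \<Longrightarrow> k \<le> x \<Longrightarrow>
    lsub_bag x D B1 D' \<Longrightarrow> lsub k q' D' r \<Longrightarrow> \<exists>p. lsub k q D p \<and> lsub x p (B0 + B1) r"
  "lsub_bag x' U T U' \<Longrightarrow> x' = Suc x \<Longrightarrow> T = image_mset (rlift k) B0 \<Longrightarrow> k \<le> x \<Longrightarrow>
    lsub_bag x D B1 D' \<Longrightarrow> lsub_bag k U' D' V \<Longrightarrow> \<exists>P. lsub_bag k U D P \<and> lsub_bag x P (B0 + B1) V"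
proof (induction x' q T q' and x' U T U' arbitrary: x k B0 D B1 D' r and x k B0 D B1 D' V
    rule: lsub_lsub_bag.inducts)
  case (ls_hit x' t)
  then obtain b where b: "B0 = {#b#}" "t = rlift k b" using singleton_eq_image_mset by metis
  with ls_hit have "D' = {#}" "r = b" using lsub_fresh_inv(1) by blast+
  with ls_hit have D: "D = {#}" "B1 = {#}" using lsub_bag_emptyR by blast+
  have "lsub k (RVar x') {#} (RVar x)"
    using ls_miss[of x' k] ls_hit by auto
  moreover have "lsub x (RVar x) {#b#} b" by (rule lsub_lsub_bag.ls_hit)
  ultimately show ?case using b D \<open>r = b\<close> by auto
next
  case (ls_miss y x')
  then have B0: "B0 = {#}" by simp
  let ?z = "if y < Suc x then y else y - 1"
  show ?case
  proof (cases "?z = k")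
    case True
    then have "y = k" using ls_miss by (auto split: if_splits)
    have "D' = {#r#}" using ls_miss True by (auto elim: lsub_RVarE)
    then obtain d where "D = {#d#}" "lsub x d B1 r" using ls_miss(5)
      by (auto elim!: lsub_bag_addRE dest: lsub_bag_emptyR)
    then show ?thesis using B0 \<open>y = k\<close> by (auto intro: lsub_lsub_bag.ls_hit)
  next
    case False
    then have r: "D' = {#}" "r = RVar (if ?z < k then ?z else ?z - 1)"
      using ls_miss by (auto elim: lsub_RVarE)
    with ls_miss have D: "D = {#}" "B1 = {#}" using lsub_bag_emptyR by blast+
    have "y \<noteq> k" using False ls_miss by auto
    from lsub_lsub_bag.ls_miss[OF this]
    have *: "lsub k (RVar y) {#} (RVar (if y < k then y else y - 1))" .
    have "(if y < k then y else y - 1) \<noteq> x" using ls_miss(1-4) \<open>y \<noteq> k\<close> by auto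
    from lsub_lsub_bag.ls_miss[OF this]
    have "lsub x (RVar (if y < k then y else y - 1)) {#} r" using r ls_miss False
      by (auto split: if_splits)
    with * D B0 show ?thesis by auto
  qed
next
  case (ls_lam x' q T q')
  from ls_lam.prems obtain r1 where r: "r = RLam r1" "lsub (Suc k) q' (image_mset (rlift 0) D') r1"
    by (auto elim: lsub_RLamE)
  have "lsub_bag (Suc x) (image_mset (rlift 0) D) (image_mset (rlift 0) B1) (image_mset (rlift 0) D')"
    using lsub_rlift(2)[OF ls_lam.prems(4)] by (simp add: lift_shift_def)
  from ls_lam.IH[OF _ _ _ this r(2), of "image_mset (rlift 0) B0"] ls_lam.prems
  obtain p where "lsub (Suc k) q (image_mset (rlift 0) D) p"
    "lsub (Suc x) p (image_mset (rlift 0) (B0 + B1)) r1" by (auto simp: image_rlift_rlift0)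
  then show ?case using r by (blast intro: lsub_lsub_bag.ls_lam)
next
  case (ls_app x' q T0 q' U T1 U')
  from ls_app.prems(2) obtain C0 C1 where
    C: "B0 = C0 + C1" "T0 = image_mset (rlift k) C0" "T1 = image_mset (rlift k) C1"
    using image_mset_eq_plusD by metis
  from ls_app.prems(5) obtain D0' D1' r1 V where
    a: "D' = D0' + D1'" "r = RApp r1 V" "lsub k q' D0' r1" "lsub_bag k U' D1' V" by (auto elim: lsub_RAppE)
  \<comment> \<open>The application distributes \<open>D'\<close> over function and argument, and
    the substitution that produced \<open>D'\<close> is split accordingly.\<close>
  from lsub_bag_unionR ls_app.prems(4) a(1) obtain D0 D1 E0 E1 where
    b: "D = D0 + D1" "B1 = E0 + E1" "lsub_bag x D0 E0 D0'" "lsub_bag x D1 E1 D1'" by metis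
  from ls_app.IH(1)[OF ls_app.prems(1) C(2) ls_app.prems(3) b(3) a(3)]
    ls_app.IH(2)[OF ls_app.prems(1) C(3) ls_app.prems(3) b(4) a(4)]
  obtain p P where "lsub k q D0 p" "lsub x p (C0 + E0) r1" "lsub_bag k U D1 P" "lsub_bag x P (C1 + E1) V" by blast
  then have "lsub k (RApp q U) D (RApp p P)" "lsub x (RApp p P) ((C0 + E0) + (C1 + E1)) r"
    using a b lsub_lsub_bag.ls_app by blast+
  moreover have "(C0 + E0) + (C1 + E1) = B0 + B1" using C b by (simp add: ac_simps)
  ultimately show ?case by auto
next
  case (lb_empty x')
  then have "D' = {#}" "V = {#}" "B0 = {#}" by (auto elim: lsub_bag_emptyE)
  with lb_empty show ?case using lsub_bag_emptyR by (auto intro: lsub_lsub_bag.lb_empty)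
next
  case (lb_add x' q T0 q' U T1 U')
  from lb_add.prems(2) obtain C0 C1 where
    C: "B0 = C0 + C1" "T0 = image_mset (rlift k) C0" "T1 = image_mset (rlift k) C1"
    using image_mset_eq_plusD by metis
  from lb_add.prems(5) obtain D0' D1' r1 V' where
    a: "D' = D0' + D1'" "V = add_mset r1 V'" "lsub k q' D0' r1" "lsub_bag k U' D1' V'" by (rule lsub_bag_addE)
  from lsub_bag_unionR lb_add.prems(4) a(1) obtain D0 D1 E0 E1 where
    b: "D = D0 + D1" "B1 = E0 + E1" "lsub_bag x D0 E0 D0'" "lsub_bag x D1 E1 D1'" by metis
  from lb_add.IH(1)[OF lb_add.prems(1) C(2) lb_add.prems(3) b(3) a(3)]
    lb_add.IH(2)[OF lb_add.prems(1) C(3) lb_add.prems(3) b(4) a(4)]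
  obtain p P where "lsub k q D0 p" "lsub x p (C0 + E0) r1" "lsub_bag k U D1 P" "lsub_bag x P (C1 + E1) V'" by blast
  then have "lsub_bag k (add_mset q U) D (add_mset p P)" "lsub_bag x (add_mset p P) ((C0 + E0) + (C1 + E1)) V"
    using a b lsub_lsub_bag.lb_add by blast+
  moreover have "(C0 + E0) + (C1 + E1) = B0 + B1" using C b by (simp add: ac_simps)
  ultimately show ?case by auto
qed

section \<open>Reduction before and after a linear substitution\<close>

definition rred :: "rterm \<Rightarrow> rterm \<Rightarrow> bool" where
  "rred s s' \<longleftrightarrow> (\<exists>S. rstep s S \<and> s' \<in> S)"

lemma rredI: "rstep s S \<Longrightarrow> s' \<in> S \<Longrightarrow> rred s s'"
  by (auto simp: rred_def)

text \<open>Linear substitution lifts its bag under each binder, so a reduction of a bag element has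
  to be lifted with it. The sum must be lifted exactly, with no result added or lost.\<close>

lemma rstep_rlift: "rstep s S \<Longrightarrow> rstep (rlift k s) (rlift k ` S)"
proof (induction arbitrary: k rule: rstep.induct)
  case (rs_redex s T)
  have c: "lift_shift k 0 (Suc k) 0" by (simp add: lift_shift_def)
  have "rlift k ` lin_subst s T = lin_subst (rlift (Suc k) s) (image_mset (rlift k) T)"
    using lsub_rlift(1)[OF _ c] lsub_rlift_inv(1)[OF _ refl refl c] by (fastforce simp: lin_subst_def)
  then show ?case using rstep.rs_redex by simp
next
  case (rs_lam s S)
  then show ?case using rstep.rs_lam[OF rs_lam.IH[of "Suc k"]] by (simp add: image_comp comp_def)
next
  case (rs_fun s S U)
  then show ?case using rstep.rs_fun[OF rs_fun.IH[of "k"]] by (simp add: image_comp comp_def)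
next
  case (rs_arg u S s U)
  then show ?case using rstep.rs_arg[OF rs_arg.IH[of "k"]] by (simp add: image_comp comp_def)
qed

lemma rred_RLam: "rred s s' \<Longrightarrow> rred (RLam s) (RLam s')"
  unfolding rred_def by (blast intro: rs_lam)

lemma rred_fun: "rred s s' \<Longrightarrow> rred (RApp s U) (RApp s' U)"
  unfolding rred_def by (blast intro: rs_fun)

lemma rred_arg: "rred u u' \<Longrightarrow> rred (RApp s (add_mset u U)) (RApp s (add_mset u' U))"
  unfolding rred_def by (blast intro: rs_arg)

text \<open>Linear substitution only replaces variables, so the redex of \<open>p\<close> is still
  present in \<open>r\<close>. Each result of contracting it there also arises by contracting first
  and substituting afterwards; at the redex itself this is \<open>lsub_commute_bwd\<close>.\<close>

lemma lsub_body_rstep: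
  "rstep p P \<Longrightarrow> lsub x p B r \<Longrightarrow> \<exists>R. rstep r R \<and> (\<forall>r'\<in>R. \<exists>p'\<in>P. lsub x p' B r')"
proof (induction arbitrary: x B r rule: rstep.induct)
  case (rs_redex q D)
  then obtain B0 B1 q' D' where *: "B = B0 + B1" "r = RApp (RLam q') D'"
    "lsub (Suc x) q (image_mset (rlift 0) B0) q'" "lsub_bag x D B1 D'"
    by (auto elim!: lsub_RAppE lsub_RLamE)
  then show ?case using lsub_commute_bwd(1)[OF *(3) refl refl _ *(4)]
    by (auto intro!: exI[of _ "lin_subst q' D'"] rstep.rs_redex simp: lin_subst_def)
next
  case (rs_lam s S)
  then obtain s' where s': "r = RLam s'" "lsub (Suc x) s (image_mset (rlift 0) B) s'"
    by (auto elim: lsub_RLamE)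
  from rs_lam.IH[OF s'(2)] obtain R where "rstep s' R" 
    "\<forall>r'\<in>R. \<exists>p'\<in>S. lsub (Suc x) p' (image_mset (rlift 0) B) r'" by blast
  then show ?case using s'
    by - (rule exI[of _ "RLam ` R"], auto intro: rstep.rs_lam ls_lam)
next
  case (rs_fun s S U)
  then obtain B0 B1 s' V where *: "B = B0 + B1" "r = RApp s' V" "lsub x s B0 s'" "lsub_bag x U B1 V"
    by (auto elim!: lsub_RAppE)
  from rs_fun.IH[OF *(3)] obtain R where "rstep s' R" "\<forall>r'\<in>R. \<exists>p'\<in>S. lsub x p' B0 r'" by blast
  then show ?case using *
    by - (rule exI[of _ "(\<lambda>s'. RApp s' V) ` R"], auto intro: rstep.rs_fun ls_app)
next
  case (rs_arg u S s U)
  then obtain B0 B1 s' V where *: "B = B0 + B1" "r = RApp s' V" "lsub x s B0 s'" "lsub_bag x (add_mset u U) B1 V"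
    by (auto elim!: lsub_RAppE)
  from *(4) obtain C0 C1 u' V' where c: "B1 = C0 + C1" "V = add_mset u' V'" "lsub x u C0 u'" "lsub_bag x U C1 V'"
    by (rule lsub_bag_addE)
  from rs_arg.IH[OF c(3)] obtain R where "rstep u' R" "\<forall>r'\<in>R. \<exists>p'\<in>S. lsub x p' C0 r'" by blast
  then show ?case using * c
    by - (rule exI[of _ "(\<lambda>u'. RApp s' (add_mset u' V')) ` R"], auto 4 4 intro: rstep.rs_arg ls_app lb_add)
qed

text \<open>The same square in the other order: what is obtained after contracting the body can be
  obtained by substituting first. At the redex this is \<open>lsub_commute_fwd\<close>.\<close>

lemma lsub_body_rred:
  "rstep p P \<Longrightarrow> p' \<in> P \<Longrightarrow> lsub x p' B r' \<Longrightarrow> \<exists>r. lsub x p B r \<and> rred r r'"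
proof (induction arbitrary: p' x B r' rule: rstep.induct)
  case (rs_redex q D)
  then have "lsub 0 q D p'" by (simp add: lin_subst_def)
  from lsub_commute_fwd(1)[OF this _ rs_redex(2)] obtain B0 B1 q' D' where
    "B = B0 + B1" "lsub (Suc x) q (image_mset (rlift 0) B0) q'" "lsub_bag x D B1 D'" "lsub 0 q' D' r'"
    by auto
  moreover from this have "rred (RApp (RLam q') D') r'"
    by (intro rredI[OF rstep.rs_redex]) (simp add: lin_subst_def)
  ultimately show ?case by (blast intro: ls_app ls_lam)
next
  case (rs_lam s S)
  then obtain s1 s' where s': "p' = RLam s1" "s1 \<in> S" "r' = RLam s'" "lsub (Suc x) s1 (image_mset (rlift 0) B) s'"
    by (auto elim: lsub_RLamE)
  then show ?case using rs_lam.IH by (blast intro: ls_lam rred_RLam)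
next
  case (rs_fun s S U)
  then obtain s1 B0 B1 s' V where *: "p' = RApp s1 U" "s1 \<in> S" "B = B0 + B1" "r' = RApp s' V"
    "lsub x s1 B0 s'" "lsub_bag x U B1 V" by (auto elim!: lsub_RAppE)
  then show ?case using rs_fun.IH by (blast intro: ls_app rred_fun)
next
  case (rs_arg u S s U)
  then obtain u1 B0 B1 s' V where *: "p' = RApp s (add_mset u1 U)" "u1 \<in> S" "B = B0 + B1" "r' = RApp s' V"
    "lsub x s B0 s'" "lsub_bag x (add_mset u1 U) B1 V" by (auto elim!: lsub_RAppE)
  from *(6) obtain C0 C1 u' V' where c: "B1 = C0 + C1" "V = add_mset u' V'" "lsub x u1 C0 u'" "lsub_bag x U C1 V'"
    by (rule lsub_bag_addE)
  from rs_arg.IH[OF *(2) c(3)] obtain v where v: "lsub x u C0 v" "rred v u'" by blast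
  have "lsub x (RApp s (add_mset u U)) B (RApp s' (add_mset v V'))"
    using * c v by (auto intro: ls_app lb_add)
  then show ?case using rred_arg[OF v(2)] * c by blast
qed

lemma union_eq_add_mset:
  assumes "T0 + T1 = add_mset b B"
  shows "(\<exists>T0'. T0 = add_mset b T0' \<and> B = T0' + T1) \<or> (\<exists>T1'. T1 = add_mset b T1' \<and> B = T0 + T1')"
proof -
  have "b \<in># T0 + T1" using assms by simp
  then consider "b \<in># T0" | "b \<in># T1" by auto
  then show ?thesis
  proof cases
    case 1
    then obtain T0' where "T0 = add_mset b T0'" by (rule mset_add)
    then show ?thesis using assms by simp
  next
    case 2
    then obtain T1' where "T1 = add_mset b T1'" by (rule mset_add)
    then show ?thesis using assms by simp
  qed
qed

text \<open>Linearity puts \<open>b\<close> at exactly one position of \<open>r\<close>, so one step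
  of \<open>b\<close> is one step of \<open>r\<close>. The bag version has to name the element
  \<open>v\<close> that received \<open>b\<close>, since a reduction in a bag acts on a single
  element.\<close>

lemma lsub_arg_rstep:
  "lsub x p T r \<Longrightarrow> T = add_mset b B \<Longrightarrow> rstep b C \<Longrightarrow>
    \<exists>R. rstep r R \<and> (\<forall>r'\<in>R. \<exists>b'\<in>C. lsub x p (add_mset b' B) r')"
  "lsub_bag x U T V \<Longrightarrow> T = add_mset b B \<Longrightarrow> rstep b C \<Longrightarrow>
    \<exists>v V0 R. V = add_mset v V0 \<and> rstep v R \<and> (\<forall>v'\<in>R. \<exists>b'\<in>C. lsub_bag x U (add_mset b' B) (add_mset v' V0))"
proof (induction x p T r and x U T V arbitrary: b B C and b B C rule: lsub_lsub_bag.inducts)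
  case (ls_hit x t)
  then have "t = b" "B = {#}" by simp_all
  then show ?case using ls_hit(2) lsub_lsub_bag.ls_hit by blast
next
  case (ls_miss y x)
  then show ?case by simp
next
  case (ls_lam x s T s')
  from ls_lam.IH[OF _ rstep_rlift[OF ls_lam.prems(2), of 0], of "image_mset (rlift 0) B"] ls_lam.prems(1)
  obtain R where "rstep s' R" "\<forall>r'\<in>R. \<exists>b'\<in>C. lsub (Suc x) s (image_mset (rlift 0) (add_mset b' B)) r'"
    by auto
  then show ?case by - (rule exI[of _ "RLam ` R"], auto intro: rstep.rs_lam lsub_lsub_bag.ls_lam simp del: image_mset_add_mset)
next
  case (ls_app x s T0 s' U T1 V)
  from ls_app.prems(1) consider T0' where "T0 = add_mset b T0'" "B = T0' + T1"
    | T1' where "T1 = add_mset b T1'" "B = T0 + T1'"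
    using union_eq_add_mset by metis
  then show ?case
  proof cases
    case 1
    from ls_app.IH(1)[OF 1(1) ls_app.prems(2)] obtain R where
      R: "rstep s' R" "\<forall>r'\<in>R. \<exists>b'\<in>C. lsub x s (add_mset b' T0') r'" by blast
    have "\<exists>b'\<in>C. lsub x (RApp s U) (add_mset b' B) (RApp r' V)" if "r' \<in> R" for r'
      using R(2) that lsub_lsub_bag.ls_app[OF _ ls_app.hyps(2)] 1 by (metis union_mset_add_mset_left)
    then show ?thesis using rs_fun[OF R(1), of V] by blast
  next
    case 2
    from ls_app.IH(2)[OF 2(1) ls_app.prems(2)] obtain v V0 R where
      R: "V = add_mset v V0" "rstep v R" "\<forall>v'\<in>R. \<exists>b'\<in>C. lsub_bag x U (add_mset b' T1') (add_mset v' V0)" by blast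
    have "\<exists>b'\<in>C. lsub x (RApp s U) (add_mset b' B) (RApp s' (add_mset v' V0))" if "v' \<in> R" for v'
      using R(3) that lsub_lsub_bag.ls_app[OF ls_app.hyps(1)] 2 by (metis union_mset_add_mset_right)
    then show ?thesis using rs_arg[OF R(2), of s' V0] R(1) by blast
  qed
next
  case (lb_empty x)
  then show ?case by simp
next
  case (lb_add x u T0 u' U T1 V)
  from lb_add.prems(1) consider T0' where "T0 = add_mset b T0'" "B = T0' + T1"
    | T1' where "T1 = add_mset b T1'" "B = T0 + T1'"
    using union_eq_add_mset by metis
  then show ?case
  proof cases
    case 1
    from lb_add.IH(1)[OF 1(1) lb_add.prems(2)] obtain R where
      R: "rstep u' R" "\<forall>r'\<in>R. \<exists>b'\<in>C. lsub x u (add_mset b' T0') r'" by blast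
    have "\<exists>b'\<in>C. lsub_bag x (add_mset u U) (add_mset b' B) (add_mset r' V)" if "r' \<in> R" for r'
      using R(2) that lsub_lsub_bag.lb_add[OF _ lb_add.hyps(2)] 1 by (metis union_mset_add_mset_left)
    then show ?thesis using R(1) by blast
  next
    case 2
    from lb_add.IH(2)[OF 2(1) lb_add.prems(2)] obtain v V0 R where
      R: "V = add_mset v V0" "rstep v R" "\<forall>v'\<in>R. \<exists>b'\<in>C. lsub_bag x U (add_mset b' T1') (add_mset v' V0)" by blast
    have "\<exists>b'\<in>C. lsub_bag x (add_mset u U) (add_mset b' B) (add_mset v' (add_mset u' V0))" if "v' \<in> R" for v'
      using R(3) that lsub_lsub_bag.lb_add[OF lb_add.hyps(1)] 2
      by (metis union_mset_add_mset_right add_mset_commute)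
    then show ?thesis using R by - (rule exI[of _ v], rule exI[of _ "add_mset u' V0"], rule exI[of _ R], simp)
  qed
qed

lemma lsub_arg_rred:
  "lsub x p T r' \<Longrightarrow> T = add_mset b' B \<Longrightarrow> rred b b' \<Longrightarrow>
    \<exists>r. lsub x p (add_mset b B) r \<and> rred r r'"
  "lsub_bag x U T V \<Longrightarrow> T = add_mset b' B \<Longrightarrow> rred b b' \<Longrightarrow>
    \<exists>v v' V0. V = add_mset v' V0 \<and> rred v v' \<and> lsub_bag x U (add_mset b B) (add_mset v V0)"
proof (induction x p T r' and x U T V arbitrary: b b' B and b b' B rule: lsub_lsub_bag.inducts)
  case (ls_hit x t)
  then have "t = b'" "B = {#}" by simp_all
  then show ?case using ls_hit(2) lsub_lsub_bag.ls_hit by blast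
next
  case (ls_miss y x)
  then show ?case by simp
next
  case (ls_lam x s T s')
  have "rred (rlift 0 b) (rlift 0 b')" using ls_lam.prems(2) rstep_rlift by (auto simp: rred_def)
  from ls_lam.IH[OF _ this, of "image_mset (rlift 0) B"] ls_lam.prems(1)
  obtain r where "lsub (Suc x) s (image_mset (rlift 0) (add_mset b B)) r" "rred r s'" by auto
  then show ?case by (blast intro: rred_RLam lsub_lsub_bag.ls_lam)
next
  case (ls_app x s T0 s' U T1 V)
  from ls_app.prems(1) consider T0' where "T0 = add_mset b' T0'" "B = T0' + T1"
    | T1' where "T1 = add_mset b' T1'" "B = T0 + T1'"
    using union_eq_add_mset by metis
  then show ?case
  proof cases
    case 1
    from ls_app.IH(1)[OF 1(1) ls_app.prems(2)] obtain r where
      r: "lsub x s (add_mset b T0') r" "rred r s'" by blast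
    have "lsub x (RApp s U) (add_mset b B) (RApp r V)"
      using lsub_lsub_bag.ls_app[OF r(1) ls_app.hyps(2)] 1 by simp
    then show ?thesis using rred_fun[OF r(2)] by blast
  next
    case 2
    from ls_app.IH(2)[OF 2(1) ls_app.prems(2)] obtain v v' V0 where
      r: "V = add_mset v' V0" "rred v v'" "lsub_bag x U (add_mset b T1') (add_mset v V0)" by blast
    have "lsub x (RApp s U) (add_mset b B) (RApp s' (add_mset v V0))"
      using lsub_lsub_bag.ls_app[OF ls_app.hyps(1) r(3)] 2 by simp
    then show ?thesis using rred_arg[OF r(2)] r(1) by blast
  qed
next
  case (lb_empty x)
  then show ?case by simp
next
  case (lb_add x u T0 u' U T1 V)
  from lb_add.prems(1) consider T0' where "T0 = add_mset b' T0'" "B = T0' + T1"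
    | T1' where "T1 = add_mset b' T1'" "B = T0 + T1'"
    using union_eq_add_mset by metis
  then show ?case
  proof cases
    case 1
    from lb_add.IH(1)[OF 1(1) lb_add.prems(2)] obtain r where
      r: "lsub x u (add_mset b T0') r" "rred r u'" by blast
    have "lsub_bag x (add_mset u U) (add_mset b B) (add_mset r V)"
      using lsub_lsub_bag.lb_add[OF r(1) lb_add.hyps(2)] 1 by simp
    then show ?thesis using r(2) by blast
  next
    case 2
    from lb_add.IH(2)[OF 2(1) lb_add.prems(2)] obtain v v' V0 where
      r: "V = add_mset v' V0" "rred v v'" "lsub_bag x U (add_mset b T1') (add_mset v V0)" by blast
    have "lsub_bag x (add_mset u U) (add_mset b B) (add_mset v (add_mset u' V0))"
      using lsub_lsub_bag.lb_add[OF lb_add.hyps(1) r(3)] 2 by (simp add: add_mset_commute)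
    then show ?thesis using r by - (rule exI[of _ v], rule exI[of _ v'], rule exI[of _ "add_mset u' V0"], simp)
  qed
qed

section \<open>Confluence and normal forms of resource terms\<close>

inductive_cases rstep_RVarE: "rstep (RVar y) S"
inductive_cases rstep_RLamE: "rstep (RLam s) S"

lemma rstep_RAppE [consumes 1, case_names redex fn arg]:
  assumes "rstep (RApp s U) S"
  obtains p where "s = RLam p" "S = lin_subst p U"
  | S' where "S = (\<lambda>s'. RApp s' U) ` S'" "rstep s S'"
  | u S' V where "U = add_mset u V" "S = (\<lambda>u'. RApp s (add_mset u' V)) ` S'" "rstep u S'"
  using assms by cases auto

text \<open>The form is asymmetric because steps yield sums. The closing step from \<open>s'\<close>
  is taken with its full, possibly empty, sum \<open>R\<close>; as every element of \<open>R\<close>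
  has a predecessor in \<open>T\<close>, all normal forms of \<open>s'\<close> are found again below
  \<open>T\<close>.\<close>

lemma rstep_local_confluence:
  "rstep s S \<Longrightarrow> rstep s T \<Longrightarrow> s' \<in> S \<Longrightarrow>
    s' \<in> T \<or> (\<exists>R. rstep s' R \<and> (\<forall>r\<in>R. \<exists>t\<in>T. rred t r))"
proof (induction arbitrary: T s' rule: rstep.induct)
  case (rs_redex p B)
  from rs_redex.prems(1) show ?case
  proof (cases rule: rstep_RAppE)
    case (redex p')
    from redex(1) have "p' = p" by simp
    with redex(2) have "T = lin_subst p B" by simp
    with rs_redex.prems(2) have "s' \<in> T" by simp
    then show ?thesis ..
  next
    case (fn S)
    from fn(2) obtain P where P: "S = RLam ` P" "rstep p P" by (rule rstep_RLamE)
    from rs_redex(2) have "lsub 0 p B s'" by (simp add: lin_subst_def)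
    from lsub_body_rstep[OF P(2) this] obtain R where R: "rstep s' R" "\<forall>r'\<in>R. \<exists>p'\<in>P. lsub 0 p' B r'" by blast
    have "\<exists>t\<in>T. rred t r" if r: "r \<in> R" for r
    proof -
      obtain p' where "p' \<in> P" "lsub 0 p' B r" using R(2) r by blast
      then have "rred (RApp (RLam p') B) r" by (intro rredI[OF rstep.rs_redex]) (simp add: lin_subst_def)
      moreover have "RApp (RLam p') B \<in> T" using \<open>p' \<in> P\<close> by (simp add: fn(1) P(1))
      ultimately show ?thesis by blast
    qed
    then show ?thesis using R(1) by blast
  next
    case (arg u S U)
    from rs_redex(2) have "lsub 0 p (add_mset u U) s'" by (simp add: lin_subst_def arg(1))
    from lsub_arg_rstep(1)[OF this refl arg(3)] obtain R where
      R: "rstep s' R" "\<forall>r'\<in>R. \<exists>b'\<in>S. lsub 0 p (add_mset b' U) r'" by blast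
    have "\<exists>t\<in>T. rred t r" if r: "r \<in> R" for r
    proof -
      obtain b' where b: "b' \<in> S" "lsub 0 p (add_mset b' U) r" using R(2) r by blast
      then have "rred (RApp (RLam p) (add_mset b' U)) r"
        by (intro rredI[OF rstep.rs_redex]) (simp add: lin_subst_def)
      moreover have "RApp (RLam p) (add_mset b' U) \<in> T" using b(1) by (simp add: arg(2))
      ultimately show ?thesis by blast
    qed
    then show ?thesis using R(1) by blast
  qed
next
  case (rs_lam s S)
  from rs_lam.prems(1) obtain T1 where T: "T = RLam ` T1" "rstep s T1" by (auto elim: rstep_RLamE)
  from rs_lam.prems(2) obtain s1 where s1: "s' = RLam s1" "s1 \<in> S" by blast
  from rs_lam.IH[OF T(2) s1(2)] show ?case
  proof
    assume "\<exists>R. rstep s1 R \<and> (\<forall>r\<in>R. \<exists>t\<in>T1. rred t r)"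
    then obtain R where "rstep s1 R" "\<forall>r\<in>R. \<exists>t\<in>T1. rred t r" by blast
    then have "rstep s' (RLam ` R)" "\<forall>r\<in>RLam ` R. \<exists>t\<in>T. rred t r"
      using s1 T by (auto intro: rstep.rs_lam rred_RLam)
    then show ?thesis by blast
  qed (use s1 T in simp)
next
  case (rs_fun s S U)
  from rs_fun.prems(2) obtain s1 where s1: "s' = RApp s1 U" "s1 \<in> S" by blast
  from rs_fun.prems(1) show ?case
  proof (cases rule: rstep_RAppE)
    case (redex p)
    \<comment> \<open>The step in the function part took place in the body \<open>p\<close>, so
      \<open>s'\<close> still has its root redex. Contracting it closes the diagram by
      \<open>lsub_body_rred\<close>.\<close>
    then obtain P where P: "S = RLam ` P" "rstep p P" using rs_fun.hyps by (auto elim: rstep_RLamE)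
    then obtain p' where p': "s1 = RLam p'" "p' \<in> P" using s1 by blast
    have "\<exists>t\<in>T. rred t r" if "r \<in> lin_subst p' U" for r
      using lsub_body_rred[OF P(2) p'(2)] that redex by (auto simp: lin_subst_def)
    then show ?thesis using rs_redex[of p' U] p' s1 by blast
  next
    case (fn T1)
    from rs_fun.IH[OF fn(2) s1(2)] show ?thesis
    proof
      assume "\<exists>R. rstep s1 R \<and> (\<forall>r\<in>R. \<exists>t\<in>T1. rred t r)"
      then obtain R where "rstep s1 R" "\<forall>r\<in>R. \<exists>t\<in>T1. rred t r" by blast
      then have "rstep s' ((\<lambda>s'. RApp s' U) ` R)" "\<forall>r\<in>(\<lambda>s'. RApp s' U) ` R. \<exists>t\<in>T. rred t r"
        using s1 fn by (auto intro: rstep.rs_fun rred_fun)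
      then show ?thesis by blast
    qed (use s1 fn in simp)
  next
    case (arg u S1 V)
    have "rstep s' ((\<lambda>u'. RApp s1 (add_mset u' V)) ` S1)" using rs_arg[OF arg(3)] s1 arg by simp
    moreover have "rred (RApp s (add_mset u' V)) (RApp s1 (add_mset u' V))" for u'
      using rs_fun.hyps s1 by (blast intro: rred_fun rredI)
    ultimately show ?thesis using arg by blast
  qed
next
  case (rs_arg u S s U)
  from rs_arg.prems(2) obtain u1 where u1: "s' = RApp s (add_mset u1 U)" "u1 \<in> S" by blast
  from rs_arg.prems(1) show ?case
  proof (cases rule: rstep_RAppE)
    case (redex p)
    have "\<exists>t\<in>T. rred t r" if "r \<in> lin_subst p (add_mset u1 U)" for r
      using lsub_arg_rred(1)[OF _ refl rredI[OF rs_arg.hyps u1(2)], of 0 p U r] that redex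
      by (auto simp: lin_subst_def)
    then show ?thesis using rs_redex[of p "add_mset u1 U"] redex u1 by blast
  next
    case (fn T1)
    have "rstep s' ((\<lambda>s'. RApp s' (add_mset u1 U)) ` T1)" using rstep.rs_fun[OF fn(2)] u1 by simp
    moreover have "rred (RApp s' (add_mset u U)) (RApp s' (add_mset u1 U))" for s'
      using rs_arg.hyps u1 by (blast intro: rred_arg rredI)
    ultimately show ?thesis using fn by blast
  next
    case (arg v S1 V)
    \<comment> \<open>The two reduced occurrences of the bag coincide, or they are distinct and
      leave a common remainder \<open>K\<close>.\<close>
    from arg(1) consider "u = v" "U = V" | K where "U = add_mset v K" "V = add_mset u K"
      unfolding add_eq_conv_ex by blast
    then show ?thesis
    proof cases
      case 1
      with arg have "rstep u S1" by simp
      from rs_arg.IH[OF this u1(2)] show ?thesis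
      proof
        assume "\<exists>R. rstep u1 R \<and> (\<forall>r\<in>R. \<exists>t\<in>S1. rred t r)"
        then obtain R where "rstep u1 R" "\<forall>r\<in>R. \<exists>t\<in>S1. rred t r" by blast
        then have "rstep s' ((\<lambda>u'. RApp s (add_mset u' U)) ` R)"
          "\<forall>r\<in>(\<lambda>u'. RApp s (add_mset u' U)) ` R. \<exists>t\<in>T. rred t r"
          using u1 arg 1 by (auto intro: rstep.rs_arg rred_arg)
        then show ?thesis by blast
      qed (use u1 arg 1 in simp)
    next
      case 2
      have "rstep s' ((\<lambda>u'. RApp s (add_mset u' (add_mset u1 K))) ` S1)"
        using rstep.rs_arg[OF arg(3), of s "add_mset u1 K"] u1 2 by (simp add: add_mset_commute)
      moreover have "rred (RApp s (add_mset u' V)) (RApp s (add_mset u' (add_mset u1 K)))" for u'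
        using rred_arg[OF rredI[OF rs_arg.hyps u1(2)], of s "add_mset u' K"] 2
        by (simp add: add_mset_commute)
      ultimately show ?thesis using arg by blast
    qed
  qed
qed

section \<open>Termination and elementwise normal forms\<close>

primrec rsize :: "rterm \<Rightarrow> nat" where
  "rsize (RVar i) = 1"
| "rsize (RLam s) = Suc (rsize s)"
| "rsize (RApp s U) = Suc (rsize s + sum_mset (image_mset rsize U))"

lemma rsize_rlift: "rsize (rlift k s) = rsize s"
proof (induction s arbitrary: k)
  case (RApp s U)
  then have "image_mset (\<lambda>u. rsize (rlift k u)) U = image_mset rsize U" by (intro image_mset_cong) simp
  then show ?case using RApp by (simp add: multiset.map_comp comp_def)
qed auto

text \<open>No element of \<open>T\<close> is copied or discarded, and each replaces a variable of
  size 1. A contracted redex also loses its application and its abstraction, so the size drops even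
  for an empty bag.\<close>

lemma rsize_lsub:
  "lsub x s T s' \<Longrightarrow> rsize s' + size T = rsize s + sum_mset (image_mset rsize T)"
  "lsub_bag x U T U' \<Longrightarrow>
    sum_mset (image_mset rsize U') + size T = sum_mset (image_mset rsize U) + sum_mset (image_mset rsize T)"
proof (induction rule: lsub_lsub_bag.inducts)
  case (ls_lam x s T s')
  then show ?case by (simp add: multiset.map_comp comp_def rsize_rlift)
qed auto

lemma rsize_rstep: "rstep s S \<Longrightarrow> s' \<in> S \<Longrightarrow> rsize s' < rsize s"
proof (induction arbitrary: s' rule: rstep.induct)
  case (rs_redex s T)
  then have "lsub 0 s T s'" by (simp add: lin_subst_def)
  from rsize_lsub(1)[OF this] show ?case by simp
qed auto

definition Nf :: "rterm \<Rightarrow> rterm set" where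
  "Nf s = {u. rred\<^sup>*\<^sup>* s u \<and> (\<forall>S. \<not> rstep u S)}"

lemma Nf_rred: "rred s s' \<Longrightarrow> Nf s' \<subseteq> Nf s"
  by (auto simp: Nf_def)

lemma Nf_normal: "\<forall>S. \<not> rstep s S \<Longrightarrow> Nf s = {s}"
  by (auto simp: Nf_def rred_def elim: converse_rtranclpE)

lemma Nf_cases:
  assumes "u \<in> Nf s"
  shows "(u = s \<and> (\<forall>S. \<not> rstep s S)) \<or> (\<exists>S s'. rstep s S \<and> s' \<in> S \<and> u \<in> Nf s')"
proof -
  from assms have "rred\<^sup>*\<^sup>* s u" and n: "\<forall>S. \<not> rstep u S" by (auto simp: Nf_def)
  from this(1) show ?thesis
  proof (cases rule: converse_rtranclpE)
    case base
    then show ?thesis using n by simp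
  next
    case (step s')
    then show ?thesis using n by (auto simp: rred_def Nf_def)
  qed
qed

text \<open>The path from \<open>s\<close> to \<open>u\<close> begins with a step of its own,
  through some \<open>s'\<close>. Local confluence supplies another step of the smaller term
  \<open>s'\<close>; the induction hypothesis puts \<open>u\<close> below one of its results, which
  has a predecessor in \<open>T\<close>.\<close>

lemma Nf_rstep_sub: "rstep s T \<Longrightarrow> u \<in> Nf s \<Longrightarrow> \<exists>t\<in>T. u \<in> Nf t"
proof (induction "rsize s" arbitrary: s T rule: less_induct)
  case less
  from Nf_cases[OF less.prems(2)] less.prems(1) obtain S s' where
    s': "rstep s S" "s' \<in> S" "u \<in> Nf s'" by blast
  from rstep_local_confluence[OF s'(1) less.prems(1) s'(2)] show ?case
  proof
    assume "\<exists>R. rstep s' R \<and> (\<forall>r\<in>R. \<exists>t\<in>T. rred t r)"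
    then obtain R where R: "rstep s' R" "\<forall>r\<in>R. \<exists>t\<in>T. rred t r" by blast
    from less.hyps[OF rsize_rstep[OF s'(1,2)] R(1) s'(3)] R(2) show ?thesis using Nf_rred by blast
  qed (use s' in blast)
qed

lemma Nf_rstep:
  assumes S: "rstep s T"
  shows "Nf s = (\<Union>t\<in>T. Nf t)"
proof
  show "Nf s \<subseteq> (\<Union>t\<in>T. Nf t)" using Nf_rstep_sub[OF S] by blast
  show "(\<Union>t\<in>T. Nf t) \<subseteq> Nf s" using Nf_rred[OF rredI[OF S]] by blast
qed

section \<open>Finite sums and the normal form \<open>nf_r\<close>\<close>

lemma finite_submultisets: "finite {A. A \<subseteq># T}"
proof (induction T)
  case (add t T)
  have "{A. A \<subseteq># add_mset t T} \<subseteq> {A. A \<subseteq># T} \<union> add_mset t ` {A. A \<subseteq># T}"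
  proof
    fix A assume A: "A \<in> {A. A \<subseteq># add_mset t T}"
    show "A \<in> {A. A \<subseteq># T} \<union> add_mset t ` {A. A \<subseteq># T}"
    proof (cases "t \<in># A")
      case True
      then obtain B where "A = add_mset t B" by (rule mset_add)
      then show ?thesis using A by simp
    next
      case False
      then have "A \<subseteq># T" using A by (metis diff_single_trivial mem_Collect_eq subset_eq_diff_conv
            add_mset_add_single)
      then show ?thesis by simp
    qed
  qed
  then show ?case using add by (auto intro: finite_subset)
qed simp

text \<open>A result is determined by finitely many choices of how to split the bag. Finiteness is
  what allows a sum to be listed in \<open>rsum_step\<close>.\<close>

lemma finite_lsub: "finite {s'. lsub x s T s'}"
proof (induction s arbitrary: x T)
  case (RVar i)
  have "{s'. lsub x (RVar i) T s'} \<subseteq> insert (RVar (if i < x then i else i - 1)) (set_mset T)"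
    by (auto elim: lsub_RVarE)
  then show ?case by (rule finite_subset) simp
next
  case (RLam s)
  have "{s'. lsub x (RLam s) T s'} \<subseteq> RLam ` {s'. lsub (Suc x) s (image_mset (rlift 0) T) s'}"
    by (auto elim: lsub_RLamE)
  then show ?case by (rule finite_subset) (simp add: RLam)
next
  case (RApp s U)
  note fin = finite_submultisets
  have bag: "finite {V. lsub_bag x U T V}" for T
    using RApp.IH(2)
  proof (induction U arbitrary: T)
    case empty
    have "{V. lsub_bag x {#} T V} \<subseteq> {{#}}" by (auto elim: lsub_bag_emptyE)
    then show ?case by (rule finite_subset) simp
  next
    case (add u U)
    have "{V. lsub_bag x (add_mset u U) T V} \<subseteq>
      (\<Union>A\<in>{A. A \<subseteq># T}. (\<lambda>(v, V). add_mset v V) ` ({v. lsub x u A v} \<times> {V. lsub_bag x U (T - A) V}))"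
    proof
      fix V assume "V \<in> {V. lsub_bag x (add_mset u U) T V}"
      then obtain A B v V' where "T = A + B" "V = add_mset v V'" "lsub x u A v" "lsub_bag x U B V'"
        by (auto elim: lsub_bag_addE)
      then show "V \<in> (\<Union>A\<in>{A. A \<subseteq># T}. (\<lambda>(v, V). add_mset v V) ` ({v. lsub x u A v} \<times> {V. lsub_bag x U (T - A) V}))"
        by (intro UN_I[of A]) auto
    qed
    moreover have "finite {v. lsub x u A v}" "finite {V. lsub_bag x U A V}" for A using add by auto
    ultimately show ?case using fin by (elim finite_subset) (intro finite_UN_I finite_imageI finite_cartesian_product)
  qed
  have "{s'. lsub x (RApp s U) T s'} \<subseteq>
    (\<Union>A\<in>{A. A \<subseteq># T}. (\<lambda>(v, V). RApp v V) ` ({v. lsub x s A v} \<times> {V. lsub_bag x U (T - A) V}))"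
  proof
    fix V assume "V \<in> {V. lsub x (RApp s U) T V}"
    then obtain A B v V' where "T = A + B" "V = RApp v V'" "lsub x s A v" "lsub_bag x U B V'"
      by (auto elim: lsub_RAppE)
    then show "V \<in> (\<Union>A\<in>{A. A \<subseteq># T}. (\<lambda>(v, V). RApp v V) ` ({v. lsub x s A v} \<times> {V. lsub_bag x U (T - A) V}))"
      by (intro UN_I[of A]) auto
  qed
  then show ?case using fin RApp.IH(1) bag
    by (elim finite_subset) (intro finite_UN_I finite_imageI finite_cartesian_product)
qed

lemma finite_rstep: "rstep s S \<Longrightarrow> finite S"
  by (induction rule: rstep.induct) (auto simp: lin_subst_def finite_lsub)

text \<open>Each entry of the sum is kept or reduced, and \<open>Nf_rstep\<close> covers the second
  case. This invariant makes the normal form of a sum unique.\<close>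

lemma rsum_step_Nf:
  assumes "rsum_step S S'"
  shows "(\<Union>s\<in>S'. Nf s) = (\<Union>s\<in>S. Nf s)"
proof -
  from assms obtain ss Ts where *: "set ss = S" "length Ts = length ss" "S' = \<Union> (set Ts)"
    "\<forall>i < length ss. rstep (ss ! i) (Ts ! i) \<or> Ts ! i = {ss ! i}" by (auto simp: rsum_step_def)
  have "(\<Union>t\<in>Ts ! i. Nf t) = Nf (ss ! i)" if "i < length ss" for i
    using *(4) that Nf_rstep by fastforce
  then have "(\<Union>i<length ss. \<Union>t\<in>Ts ! i. Nf t) = (\<Union>i<length ss. Nf (ss ! i))" by simp
  moreover have "(\<lambda>i. Ts ! i) ` {..<length ss} = set Ts" "(\<lambda>i. ss ! i) ` {..<length ss} = S"
    using *(1,2) nth_image[of "length ss" ss] nth_image[of "length ss" Ts] by (simp_all add: lessThan_atLeast0)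
  ultimately show ?thesis using *(3) by (metis UN_extend_simps(9) image_image)
qed

lemma rsum_step_finite:
  assumes "rsum_step S S'"
  shows "finite S'"
proof -
  from assms obtain ss Ts where *: "length Ts = length ss" "S' = \<Union> (set Ts)"
    "\<forall>i < length ss. rstep (ss ! i) (Ts ! i) \<or> Ts ! i = {ss ! i}" by (auto simp: rsum_step_def)
  then have "finite T" if "T \<in> set Ts" for T
    using that finite_rstep by (metis finite.emptyI finite_insert in_set_conv_nth)
  then show ?thesis using *(2) by simp
qed

lemma rsum_step_single: "rstep s S \<Longrightarrow> rsum_step {s} S"
  unfolding rsum_step_def by (rule exI[of _ "[s]"], rule exI[of _ "[S]"]) simp

text \<open>The terms of \<open>A\<close> are appended as entries that are kept. A term of both
  \<open>S\<close> and \<open>A\<close> is listed twice, once for each role, which sums as sets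
  permit.\<close>

lemma rsum_step_Un:
  assumes "rsum_step S S'" "finite A"
  shows "rsum_step (S \<union> A) (S' \<union> A)"
proof -
  from assms obtain ss Ts where *: "set ss = S" "length Ts = length ss" "S' = \<Union> (set Ts)"
    "\<forall>i < length ss. rstep (ss ! i) (Ts ! i) \<or> Ts ! i = {ss ! i}"
    "\<exists>i < length ss. rstep (ss ! i) (Ts ! i)" by (auto simp: rsum_step_def)
  obtain as where as: "set as = A" using assms(2) finite_list by blast
  let ?Ts = "Ts @ map (\<lambda>a. {a}) as"
  have "set (ss @ as) = S \<union> A" "length ?Ts = length (ss @ as)" "S' \<union> A = \<Union> (set ?Ts)"
    using * as by auto
  moreover have "\<forall>i < length (ss @ as). rstep ((ss @ as) ! i) (?Ts ! i) \<or> ?Ts ! i = {(ss @ as) ! i}"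
    using *(2,4) by (auto simp: nth_append)
  moreover from *(5) obtain i where "i < length ss" "rstep (ss ! i) (Ts ! i)" by blast
  then have "i < length (ss @ as)" "rstep ((ss @ as) ! i) (?Ts ! i)" using *(2) by (auto simp: nth_append)
  ultimately show ?thesis unfolding rsum_step_def by blast
qed

lemma rsum_steps_Un: "rsum_step\<^sup>*\<^sup>* S S' \<Longrightarrow> finite A \<Longrightarrow> rsum_step\<^sup>*\<^sup>* (S \<union> A) (S' \<union> A)"
proof (induction rule: rtranclp_induct)
  case (step T U)
  then show ?case by (meson rsum_step_Un rtranclp.rtrancl_into_rtrancl)
qed auto

text \<open>The elements of \<open>T\<close> are normalised one after another. The set
  \<open>A\<close> of frozen terms is arbitrary in the induction, as it has to absorb the sums
  already obtained.\<close>

lemma rsum_steps_finite_union: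
  "finite T \<Longrightarrow> (\<And>t. t \<in> T \<Longrightarrow> rsum_step\<^sup>*\<^sup>* {t} (F t) \<and> finite (F t)) \<Longrightarrow> finite A \<Longrightarrow>
    rsum_step\<^sup>*\<^sup>* (T \<union> A) (\<Union> (F ` T) \<union> A)"
proof (induction T arbitrary: A rule: finite_induct)
  case (insert t T)
  have "rsum_step\<^sup>*\<^sup>* ({t} \<union> (T \<union> A)) (F t \<union> (T \<union> A))"
    using insert by (intro rsum_steps_Un) auto
  moreover have "rsum_step\<^sup>*\<^sup>* (T \<union> (F t \<union> A)) (\<Union> (F ` T) \<union> (F t \<union> A))"
    using insert by auto
  ultimately have "rsum_step\<^sup>*\<^sup>* ({t} \<union> (T \<union> A)) (\<Union> (F ` T) \<union> (F t \<union> A))"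
    by (simp add: Un_left_commute)
  then show ?case by (simp add: ac_simps)
qed auto

lemma rsum_steps_Nf: "rsum_step\<^sup>*\<^sup>* {s} (Nf s) \<and> finite (Nf s)"
proof (induction "rsize s" arbitrary: s rule: less_induct)
  case less
  show ?case
  proof (cases "\<exists>S. rstep s S")
    case True
    then obtain S where S: "rstep s S" by blast
    have *: "rsum_step\<^sup>*\<^sup>* {t} (Nf t) \<and> finite (Nf t)" if "t \<in> S" for t
      using less[OF rsize_rstep[OF S that]] .
    from rsum_steps_finite_union[OF finite_rstep[OF S] *, of "{}"]
    have "rsum_step\<^sup>*\<^sup>* S (Nf s)" by (simp add: Nf_rstep[OF S])
    then have "rsum_step\<^sup>*\<^sup>* {s} (Nf s)" using rsum_step_single[OF S] by (rule converse_rtranclp_into_rtranclp[rotated])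
    moreover have "finite (Nf s)" using * finite_rstep[OF S] by (simp add: Nf_rstep[OF S])
    ultimately show ?thesis by blast
  next
    case False
    then show ?thesis by (simp add: Nf_normal)
  qed
qed

lemma rnormal_iff: "finite S \<Longrightarrow> rnormal S \<longleftrightarrow> (\<forall>s\<in>S. \<forall>T. \<not> rstep s T)"
proof
  assume fin: "finite S" and n: "rnormal S"
  show "\<forall>s\<in>S. \<forall>T. \<not> rstep s T"
  proof (intro ballI allI notI)
    fix s T assume "s \<in> S" "rstep s T"
    \<comment> \<open>By idempotence \<open>S\<close> is also \<open>{s} \<union> S\<close>: one
      copy of \<open>s\<close> is reduced and another is kept.\<close>
    from rsum_step_Un[OF rsum_step_single[OF this(2)] fin] this(1) have "rsum_step S (T \<union> S)"
      by (simp add: insert_absorb)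
    then show False using n by (auto simp: rnormal_def)
  qed
qed (auto simp: rnormal_def rsum_step_def)

text \<open>A normal sum reached from \<open>{s}\<close> has the same union of normal forms as
  \<open>{s}\<close>, and each of its terms is its own only normal form; this fixes the description
  operator.\<close>

lemma nf_r_eq_Nf: "nf_r s = Nf s"
  unfolding nf_r_def
proof (rule the_equality)
  show "rsum_step\<^sup>*\<^sup>* {s} (Nf s) \<and> rnormal (Nf s)"
    using rsum_steps_Nf[of s] by (simp add: rnormal_iff) (simp add: Nf_def)
next
  fix S assume S: "rsum_step\<^sup>*\<^sup>* {s} S \<and> rnormal S"
  then have "rsum_step\<^sup>*\<^sup>* {s} S" by simp
  then have "finite S \<and> (\<Union>s\<in>S. Nf s) = Nf s"
    by (induction rule: rtranclp_induct) (auto simp: rsum_step_finite rsum_step_Nf)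
  then show "S = Nf s" using S Nf_normal by (auto simp: rnormal_iff)
qed

section \<open>Approximants and reduction\<close>

lemma lift_simps [simp]:
  "lift k (LVar i) = LVar (if i < k then i else Suc i)"
  "lift k LBot = LBot"
  "lift k (LLam P) = LLam (lift (Suc k) P)"
  "lift k (LApp P Q) = LApp (lift k P) (lift k Q)"
  by (subst lift.code, simp)+

lemma subst_simps [simp]:
  "subst k N (LVar i) = (if i = k then N else LVar (if i < k then i else i - 1))"
  "subst k N LBot = LBot"
  "subst k N (LLam P) = LLam (subst (Suc k) (lift 0 N) P)"
  "subst k N (LApp P Q) = LApp (subst k N P) (subst k N Q)"
  by (subst subst.code, simp)+

lemma abs_ren_simps [simp]:
  "abs_ren j d (LVar i) = LVar (if i < d then i else if i - d = j then d else Suc i)"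
  "abs_ren j d LBot = LBot"
  "abs_ren j d (LLam P) = LLam (abs_ren j (Suc d) P)"
  "abs_ren j d (LApp P Q) = LApp (abs_ren j d P) (abs_ren j d Q)"
  by (subst abs_ren.code, simp)+

inductive_cases taylor_LVarE: "taylor_approx s (LVar i)"
inductive_cases taylor_LBotE: "taylor_approx s LBot"
inductive_cases taylor_LLamE: "taylor_approx s (LLam P)"
inductive_cases taylor_LAppE: "taylor_approx s (LApp P Q)"
inductive_cases taylor_RVarE: "taylor_approx (RVar i) M"
inductive_cases taylor_RLamE: "taylor_approx (RLam s) M"
inductive_cases taylor_RAppE: "taylor_approx (RApp s U) M"

lemma taylor_lift: "taylor_approx t N \<Longrightarrow> taylor_approx (rlift k t) (lift k N)"
  by (induction arbitrary: k rule: taylor_approx.induct) (auto intro!: taylor_approx.intros)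

text \<open>Witnesses are chosen occurrence by occurrence, so that multiplicities are
  respected.\<close>

lemma mset_choice:
  assumes "\<forall>t\<in>#T. \<exists>u. R t u"
  shows "\<exists>U. rel_mset R T U"
  using assms
proof (induction T)
  case empty
  then show ?case by (auto intro: rel_mset_Zero)
next
  case (add t T)
  then obtain u U where "R t u" "rel_mset R T U" by auto
  then show ?case by (blast intro: rel_mset_Plus)
qed

lemma rel_mset_induct_fixed [consumes 1, case_names empty add]:
  assumes "rel_mset R A B" "P {#} {#}"
    and "\<And>a b A B. R a b \<Longrightarrow> rel_mset R A B \<Longrightarrow> P A B \<Longrightarrow> P (add_mset a A) (add_mset b B)"
  shows "P A B"
proof -
  have "P A B" if "rel_mset R' A B" "R' = R" for R'
    using that by (induction rule: rel_mset_induct) (use assms(2,3) in auto)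
  then show ?thesis using assms(1) by blast
qed

lemma taylor_lift_inv: "taylor_approx s (lift k N) \<Longrightarrow> \<exists>t. s = rlift k t \<and> taylor_approx t N"
proof (induction s arbitrary: k N)
  case (RVar i)
  then obtain l where "N = LVar l" "i = (if l < k then l else Suc l)"
    by (cases N) (auto elim: taylor_RVarE)
  then show ?case by (intro exI[of _ "RVar l"]) (auto intro: ta_var)
next
  case (RLam s)
  then obtain P where "N = LLam P" "taylor_approx s (lift (Suc k) P)"
    by (cases N) (auto elim: taylor_RLamE)
  with RLam.IH[of "Suc k" P] obtain t where "s = rlift (Suc k) t" "taylor_approx t P" by blast
  then show ?case using \<open>N = LLam P\<close> by (intro exI[of _ "RLam t"]) (auto intro: ta_lam)
next
  case (RApp s U)
  then obtain P Q where N: "N = LApp P Q" and s: "taylor_approx s (lift k P)"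
    and U: "\<forall>u\<in>#U. taylor_approx u (lift k Q)"
    by (cases N) (auto elim: taylor_RAppE)
  from RApp.IH(1)[OF s] obtain t where t: "s = rlift k t" "taylor_approx t P" by blast
  have "\<forall>u\<in>#U. \<exists>v. u = rlift k v \<and> taylor_approx v Q" using RApp.IH(2) U by blast
  from mset_choice[OF this] obtain V where V: "rel_mset (\<lambda>u v. u = rlift k v \<and> taylor_approx v Q) U V" by blast
  then have "U = image_mset (rlift k) V \<and> (\<forall>v\<in>#V. taylor_approx v Q)"
    by (induction rule: rel_mset_induct_fixed) auto
  then show ?case using N t by (intro exI[of _ "RApp t V"]) (auto intro: ta_app)
qed

lemma taylor_lsub:
  "lsub x s T s' \<Longrightarrow> taylor_approx s P \<Longrightarrow> \<forall>t\<in>#T. taylor_approx t N \<Longrightarrow>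
    taylor_approx s' (subst x N P)"
  "lsub_bag x U T U' \<Longrightarrow> \<forall>u\<in>#U. taylor_approx u P \<Longrightarrow> \<forall>t\<in>#T. taylor_approx t N \<Longrightarrow>
    \<forall>u'\<in>#U'. taylor_approx u' (subst x N P)"
proof (induction x s T s' and x U T U' arbitrary: P N and P N rule: lsub_lsub_bag.inducts)
  case (ls_hit x t)
  then show ?case by (auto elim: taylor_RVarE)
next
  case (ls_miss y x)
  then have "P = LVar y" by (auto elim: taylor_RVarE)
  then show ?case using ls_miss(1) by (simp add: ta_var)
next
  case (ls_lam x s T s')
  from ls_lam.prems(1) obtain P' where P: "P = LLam P'" "taylor_approx s P'" by (auto elim: taylor_RLamE)
  have "\<forall>t\<in>#image_mset (rlift 0) T. taylor_approx t (lift 0 N)" using ls_lam.prems(2) taylor_lift by auto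
  from ls_lam.IH[OF P(2) this] show ?case by (simp add: P(1) ta_lam)
next
  case (ls_app x s T0 s' U T1 U')
  from ls_app.prems(1) obtain P1 Q where P: "P = LApp P1 Q" "taylor_approx s P1" "\<forall>u\<in>#U. taylor_approx u Q"
    by (auto elim: taylor_RAppE)
  then show ?case using ls_app.IH(1)[OF P(2), of N] ls_app.IH(2)[OF P(3), of N] ls_app.prems(2)
    by (simp add: ta_app)
next
  case (lb_empty x)
  then show ?case by simp
next
  case (lb_add x u T0 u' U T1 U')
  then show ?case by simp
qed

text \<open>The finite approximant \<open>s'\<close> is cut where copies of \<open>N\<close> were
  inserted: \<open>T\<close> collects the pieces below the cuts, and \<open>s\<close> has variables
  in their place. The induction is on \<open>s'\<close> because \<open>P\<close> may be
  infinite.\<close>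

lemma taylor_subst_inv:
  "taylor_approx s' (subst x N P) \<Longrightarrow>
    \<exists>s T. taylor_approx s P \<and> (\<forall>t\<in>#T. taylor_approx t N) \<and> lsub x s T s'"
proof (induction s' arbitrary: x N P)
  case (RVar i)
  show ?case
  proof (cases P)
    case (LVar l)
    show ?thesis
    proof (cases "l = x")
      case True
      then have "\<forall>t\<in>#{#RVar i#}. taylor_approx t N" using RVar LVar by simp
      then show ?thesis using LVar True ls_hit ta_var by blast
    next
      case False
      then have "RVar i = RVar (if l < x then l else l - 1)" using RVar LVar by (auto elim: taylor_RVarE)
      then have "lsub x (RVar l) {#} (RVar i)" using ls_miss[OF False] by simp
      moreover have "\<forall>t\<in>#{#}. taylor_approx t N" by simp
      ultimately show ?thesis using LVar ta_var by blast
    qed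
  qed (use RVar in \<open>auto elim: taylor_RVarE\<close>)
next
  case (RLam s')
  show ?case
  proof (cases P)
    case (LVar l)
    then have "l = x" using RLam.prems by (auto elim: taylor_RLamE split: if_splits)
    then have "\<forall>t\<in>#{#RLam s'#}. taylor_approx t N" using RLam.prems LVar by simp
    then show ?thesis using LVar \<open>l = x\<close> ls_hit ta_var by blast
  next
    case (LLam Q)
    then have "taylor_approx s' (subst (Suc x) (lift 0 N) Q)" using RLam.prems by (auto elim: taylor_RLamE)
    from RLam.IH[OF this] obtain s T where *: "taylor_approx s Q" "\<forall>t\<in>#T. taylor_approx t (lift 0 N)"
      "lsub (Suc x) s T s'" by blast
    \<comment> \<open>The pieces found under the binder approximate the lifted \<open>N\<close>, so
      they are lifts of approximants of \<open>N\<close>.\<close>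
    have "\<forall>t\<in>#T. \<exists>v. t = rlift 0 v \<and> taylor_approx v N" using *(2) taylor_lift_inv by blast
    from mset_choice[OF this] obtain V where V: "rel_mset (\<lambda>u v. u = rlift 0 v \<and> taylor_approx v N) T V" by blast
    then have V: "T = image_mset (rlift 0) V \<and> (\<forall>v\<in>#V. taylor_approx v N)"
      by (induction rule: rel_mset_induct_fixed) auto
    then have "lsub x (RLam s) V (RLam s')" using *(3) ls_lam by simp
    then show ?thesis using V *(1) LLam ta_lam by blast
  qed (use RLam.prems in \<open>auto elim: taylor_RLamE\<close>)
next
  case (RApp s' U')
  show ?case
  proof (cases P)
    case (LVar l)
    then have "l = x" using RApp.prems by (auto elim: taylor_RAppE split: if_splits)
    then have "\<forall>t\<in>#{#RApp s' U'#}. taylor_approx t N" using RApp.prems LVar by simp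
    then show ?thesis using LVar \<open>l = x\<close> ls_hit ta_var by blast
  next
    case (LApp P1 Q)
    then have s': "taylor_approx s' (subst x N P1)" and U': "\<forall>u\<in>#U'. taylor_approx u (subst x N Q)"
      using RApp.prems by (auto elim: taylor_RAppE)
    from RApp.IH(1)[OF s'] obtain s T0 where *: "taylor_approx s P1" "\<forall>t\<in>#T0. taylor_approx t N"
      "lsub x s T0 s'" by blast
    have "\<forall>u'\<in>#U'. \<exists>u T. taylor_approx u Q \<and> (\<forall>t\<in>#T. taylor_approx t N) \<and> lsub x u T u'"
      using RApp.IH(2) U' by blast
    then have "\<exists>U T. (\<forall>u\<in>#U. taylor_approx u Q) \<and> (\<forall>t\<in>#T. taylor_approx t N) \<and> lsub_bag x U T U'"
    proof (induction U')
      case empty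
      show ?case by (intro exI[of _ "{#}"]) (simp add: lb_empty)
    next
      case (add u' U')
      then obtain U T where U: "\<forall>u\<in>#U. taylor_approx u Q" "\<forall>t\<in>#T. taylor_approx t N" "lsub_bag x U T U'"
        by (metis union_iff add_mset_add_single)
      from add.prems obtain u T0 where u: "taylor_approx u Q" "\<forall>t\<in>#T0. taylor_approx t N" "lsub x u T0 u'"
        by (metis union_single_eq_member)
      have "\<forall>v\<in>#add_mset u U. taylor_approx v Q" "\<forall>t\<in>#T0 + T. taylor_approx t N" using u U by auto
      then show ?case using lb_add[OF u(3) U(3)] by blast
    qed
    then obtain U T1 where U: "\<forall>u\<in>#U. taylor_approx u Q" "\<forall>t\<in>#T1. taylor_approx t N" "lsub_bag x U T1 U'"
      by blast
    have "taylor_approx (RApp s U) P" using LApp *(1) U(1) by (simp add: ta_app)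
    moreover have "\<forall>t\<in>#T0 + T1. taylor_approx t N" using *(2) U(2) by auto
    ultimately show ?thesis using ls_app[OF *(3) U(3)] by blast
  qed (use RApp.prems in \<open>auto elim: taylor_RAppE\<close>)
qed

text \<open>The head redex never lies inside an argument, so every approximant contains it exactly
  once and follows its contraction in one step. A redex inside an argument may have several copies,
  or none.\<close>

lemma taylor_hred:
  "hred M M' \<Longrightarrow> taylor_approx s M \<Longrightarrow> \<exists>S. rstep s S \<and> (\<forall>s'\<in>S. taylor_approx s' M')"
proof (induction arbitrary: s rule: hred.induct)
  case (hred_redex P Q)
  then obtain p T where s: "s = RApp (RLam p) T" "taylor_approx p P" "\<forall>t\<in>#T. taylor_approx t Q"
    by (auto elim!: taylor_LAppE taylor_LLamE)
  have "\<forall>s'\<in>lin_subst p T. taylor_approx s' (beta_contract P Q)"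
    using taylor_lsub(1)[OF _ s(2,3)] by (simp add: lin_subst_def beta_contract_def)
  then show ?case using rs_redex[of p T] s(1) by blast
next
  case (hred_lam P P')
  then obtain p where p: "s = RLam p" "taylor_approx p P" by (auto elim: taylor_LLamE)
  from hred_lam.IH[OF p(2)] obtain S where "rstep p S" "\<forall>s'\<in>S. taylor_approx s' P'" by blast
  then show ?case using p(1) by (intro exI[of _ "RLam ` S"]) (auto intro: rs_lam ta_lam)
next
  case (hred_app P P' Q)
  then obtain p T where p: "s = RApp p T" "taylor_approx p P" "\<forall>t\<in>#T. taylor_approx t Q"
    by (auto elim: taylor_LAppE)
  from hred_app.IH[OF p(2)] obtain S where "rstep p S" "\<forall>s'\<in>S. taylor_approx s' P'" by blast
  then show ?case using p(1,3) by (intro exI[of _ "(\<lambda>p. RApp p T) ` S"]) (auto intro: rs_fun ta_app)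
qed

lemma rreds_RLam: "rred\<^sup>*\<^sup>* s s' \<Longrightarrow> rred\<^sup>*\<^sup>* (RLam s) (RLam s')"
  by (induction rule: rtranclp_induct) (auto intro: rred_RLam rtranclp.rtrancl_into_rtrancl)

lemma rreds_fun: "rred\<^sup>*\<^sup>* s s' \<Longrightarrow> rred\<^sup>*\<^sup>* (RApp s U) (RApp s' U)"
  by (induction rule: rtranclp_induct) (auto intro: rred_fun rtranclp.rtrancl_into_rtrancl)

lemma rreds_arg: "rred\<^sup>*\<^sup>* u u' \<Longrightarrow> rred\<^sup>*\<^sup>* (RApp s (add_mset u U)) (RApp s (add_mset u' U))"
  by (induction rule: rtranclp_induct) (auto intro: rred_arg rtranclp.rtrancl_into_rtrancl)

lemma rreds_bag: "rel_mset rred\<^sup>*\<^sup>* U U' \<Longrightarrow> rred\<^sup>*\<^sup>* (RApp s (U + V)) (RApp s (U' + V))"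
proof (induction U U' arbitrary: V rule: rel_mset_induct_fixed)
  case (add u u' U U')
  have "rred\<^sup>*\<^sup>* (RApp s (add_mset u (U + V))) (RApp s (add_mset u' (U + V)))"
    using add(1) by (rule rreds_arg)
  also have "rred\<^sup>*\<^sup>* (RApp s (add_mset u' (U + V))) (RApp s (add_mset u' (U' + V)))"
    using add(3)[of "add_mset u' V"] by simp
  finally show ?case by simp
qed simp

lemma rreds_RApp:
  assumes "rred\<^sup>*\<^sup>* s s'" "rel_mset rred\<^sup>*\<^sup>* U U'"
  shows "rred\<^sup>*\<^sup>* (RApp s U) (RApp s' U')"
  using rreds_fun[OF assms(1), of U] rreds_bag[OF assms(2), of s' "{#}"] by (simp add: rtranclp_trans)

text \<open>An approximant of the reduct is traced back to the source. A redex in an argument may be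
  represented several times or not at all, so the path connecting the two approximants has arbitrary
  length.\<close>

lemma taylor_beta:
  "beta M M' \<Longrightarrow> taylor_approx s' M' \<Longrightarrow> \<exists>s. taylor_approx s M \<and> rred\<^sup>*\<^sup>* s s'"
proof (induction arbitrary: s' rule: beta.induct)
  case (beta_redex P Q)
  then obtain p T where *: "taylor_approx p P" "\<forall>t\<in>#T. taylor_approx t Q" "lsub 0 p T s'"
    using taylor_subst_inv unfolding beta_contract_def by blast
  have "rred (RApp (RLam p) T) s'" using rs_redex by (rule rredI) (simp add: lin_subst_def *(3))
  moreover have "taylor_approx (RApp (RLam p) T) (LApp (LLam P) Q)"
    using * by (blast intro: taylor_approx.intros)
  ultimately show ?case by blast
next
  case (beta_lam P P')
  then obtain p' where p': "s' = RLam p'" "taylor_approx p' P'" by (auto elim: taylor_LLamE)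
  from beta_lam.IH[OF p'(2)] show ?case using p'(1) by (blast intro: ta_lam rreds_RLam)
next
  case (beta_fun P P' Q)
  then obtain p' T where p': "s' = RApp p' T" "taylor_approx p' P'" "\<forall>t\<in>#T. taylor_approx t Q"
    by (auto elim: taylor_LAppE)
  from beta_fun.IH[OF p'(2)] show ?case using p'(1,3) by (blast intro: ta_app rreds_fun)
next
  case (beta_arg Q Q' P)
  then obtain p T' where p: "s' = RApp p T'" "taylor_approx p P" "\<forall>t\<in>#T'. taylor_approx t Q'"
    by (auto elim: taylor_LAppE)
  have "\<forall>t'\<in>#T'. \<exists>t. taylor_approx t Q \<and> rred\<^sup>*\<^sup>* t t'" using p(3) beta_arg.IH by blast
  from mset_choice[OF this] obtain T where T: "rel_mset (\<lambda>t' t. taylor_approx t Q \<and> rred\<^sup>*\<^sup>* t t') T' T" by blast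
  then have "(\<forall>t\<in>#T. taylor_approx t Q) \<and> rel_mset rred\<^sup>*\<^sup>* T T'"
    by (induction rule: rel_mset_induct_fixed) (auto intro: rel_mset_Zero rel_mset_Plus)
  then have "taylor_approx (RApp p T) (LApp P Q)" "rred\<^sup>*\<^sup>* (RApp p T) s'"
    using p by (auto intro: ta_app rreds_RApp)
  then show ?case by blast
qed

lemma Nf_rreds: "rred\<^sup>*\<^sup>* s s' \<Longrightarrow> Nf s' \<subseteq> Nf s"
  by (auto simp: Nf_def)

section \<open>Normal forms of Taylor expansions and head normal forms\<close>

definition NF_Taylor :: "lterm \<Rightarrow> rterm set" where
  "NF_Taylor M = {u. \<exists>s. taylor_approx s M \<and> u \<in> Nf s}"

lemma NF_r_Taylor: "NF_r (Taylor M) = NF_Taylor M"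
  by (auto simp: NF_r_def Taylor_def NF_Taylor_def nf_r_eq_Nf)

lemma NF_Taylor_beta: "beta M M' \<Longrightarrow> NF_Taylor M' \<subseteq> NF_Taylor M"
  using taylor_beta Nf_rreds unfolding NF_Taylor_def by blast

lemma NF_Taylor_betas: "beta_star M M' \<Longrightarrow> NF_Taylor M' \<subseteq> NF_Taylor M"
  by (induction rule: rtranclp_induct) (use NF_Taylor_beta in blast)+

lemma hred_beta: "hred M M' \<Longrightarrow> beta M M'"
  by (induction rule: hred.induct) (auto intro: beta.intros)

lemma NF_Taylor_hred:
  assumes "hred M M'"
  shows "NF_Taylor M = NF_Taylor M'"
proof
  show "NF_Taylor M' \<subseteq> NF_Taylor M" using assms hred_beta NF_Taylor_beta by blast
  show "NF_Taylor M \<subseteq> NF_Taylor M'"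
  proof
    fix u assume "u \<in> NF_Taylor M"
    then obtain s where s: "taylor_approx s M" "u \<in> Nf s" by (auto simp: NF_Taylor_def)
    from taylor_hred[OF assms s(1)] obtain S where "rstep s S" "\<forall>s'\<in>S. taylor_approx s' M'" by blast
    with s(2) show "u \<in> NF_Taylor M'" by (auto simp: NF_Taylor_def Nf_rstep)
  qed
qed

lemma NF_Taylor_hreds: "hred\<^sup>*\<^sup>* M M' \<Longrightarrow> NF_Taylor M = NF_Taylor M'"
  by (induction rule: rtranclp_induct) (auto simp: NF_Taylor_hred)

lemma lams_simps [simp]: "lams 0 P = P" "lams (Suc m) P = LLam (lams m P)"
  by (simp_all add: lams_def)

lemma apps_simps [simp]: "apps H [] = H" "apps H (N # Ns) = apps (LApp H N) Ns"
  "apps H (Ns @ [N]) = LApp (apps H Ns) N"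
  by (simp_all add: apps_def)

definition has_hnf :: "lterm \<Rightarrow> bool" where
  "has_hnf M \<longleftrightarrow> (\<exists>m y Ns. hred\<^sup>*\<^sup>* M (lams m (apps (LVar y) Ns)))"

text \<open>The existence of a finite approximant excludes an infinite head spine and a head
  \<open>LBot\<close>, so induction on the approximation reaches the head of
  \<open>M\<close>.\<close>

lemma taylor_hnf_or_hred:
  "taylor_approx s M \<Longrightarrow> (\<exists>m y Ns. M = lams m (apps (LVar y) Ns)) \<or> (\<exists>M'. hred M M')"
proof (induction rule: taylor_approx.induct)
  case (ta_var x)
  have "LVar x = lams 0 (apps (LVar x) [])" by simp
  then show ?case by blast
next
  case (ta_lam s M)
  then show ?case by (metis hred_lam lams_simps(2))
next
  case (ta_app s M T N)
  show ?case
  proof (cases "is_LLam M")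
    case True
    then show ?thesis by (metis hred_redex lterm.collapse(2))
  next
    case False
    from ta_app.IH(1) show ?thesis
    proof
      assume "\<exists>m y Ns. M = lams m (apps (LVar y) Ns)"
      then obtain m y Ns where M: "M = lams m (apps (LVar y) Ns)" by blast
      with False have "m = 0" by (cases m) auto
      with M have "LApp M N = lams 0 (apps (LVar y) (Ns @ [N]))" by simp
      then show ?thesis by blast
    qed (use False hred_app in blast)
  qed
qed

text \<open>Each head step of \<open>M\<close> is followed by an approximant of smaller size. Among
  the resulting terms, one that still has \<open>u\<close> as a normal form is selected, so the sum
  never dies out and head reduction must end.\<close>

lemma Nf_has_hnf: "taylor_approx s M \<Longrightarrow> u \<in> Nf s \<Longrightarrow> has_hnf M"
proof (induction "rsize s" arbitrary: s M rule: less_induct)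
  case less
  from taylor_hnf_or_hred[OF less.prems(1)] show ?case
  proof
    assume "\<exists>M'. hred M M'"
    then obtain M' where M': "hred M M'" by blast
    from taylor_hred[OF this less.prems(1)] obtain S where
      S: "rstep s S" "\<forall>s'\<in>S. taylor_approx s' M'" by blast
    from Nf_rstep_sub[OF S(1) less.prems(2)] obtain s' where "s' \<in> S" "u \<in> Nf s'" by blast
    with less.hyps[OF rsize_rstep[OF S(1)]] S(2) have "has_hnf M'" by blast
    then show ?thesis using M' unfolding has_hnf_def by (meson converse_rtranclp_into_rtranclp)
  qed (auto simp: has_hnf_def)
qed

lemma NF_Taylor_has_hnf: "u \<in> NF_Taylor M \<Longrightarrow> has_hnf M"
  using Nf_has_hnf by (auto simp: NF_Taylor_def)

section \<open>Normal forms of abstractions and of applications headed by a variable\<close>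

lemma rreds_RLam_inv: "rred\<^sup>*\<^sup>* (RLam s) v \<Longrightarrow> \<exists>s'. v = RLam s' \<and> rred\<^sup>*\<^sup>* s s'"
proof (induction rule: rtranclp_induct)
  case (step v w)
  then obtain s' where s': "v = RLam s'" "rred\<^sup>*\<^sup>* s s'" by blast
  with step(2) obtain s'' where "w = RLam s''" "rred s' s''" by (auto simp: rred_def elim!: rstep_RLamE)
  then show ?case using s' rtranclp.rtrancl_into_rtrancl[of rred s s' s''] by blast
qed simp

lemma rstep_RLam_iff: "(\<exists>S. rstep (RLam s) S) \<longleftrightarrow> (\<exists>S. rstep s S)"
  by (auto intro: rs_lam elim: rstep_RLamE)

lemma Nf_RLam: "Nf (RLam s) = RLam ` Nf s"
proof
  show "Nf (RLam s) \<subseteq> RLam ` Nf s"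
  proof
    fix u assume "u \<in> Nf (RLam s)"
    then have u: "rred\<^sup>*\<^sup>* (RLam s) u" "\<forall>S. \<not> rstep u S" by (auto simp: Nf_def)
    from rreds_RLam_inv[OF u(1)] obtain s' where "u = RLam s'" "rred\<^sup>*\<^sup>* s s'" by blast
    with u(2) rstep_RLam_iff[of s'] show "u \<in> RLam ` Nf s" unfolding Nf_def by blast
  qed
  show "RLam ` Nf s \<subseteq> Nf (RLam s)" using rreds_RLam rstep_RLam_iff by (auto simp: Nf_def)
qed

lemma NF_Taylor_LVar: "NF_Taylor (LVar y) = {RVar y}"
proof -
  have "Nf (RVar y) = {RVar y}" by (rule Nf_normal) (auto elim: rstep_RVarE)
  then show ?thesis by (auto simp: NF_Taylor_def intro: ta_var elim!: taylor_LVarE)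
qed

lemma NF_Taylor_LLam: "NF_Taylor (LLam P) = RLam ` NF_Taylor P"
  by (auto simp: NF_Taylor_def Nf_RLam image_iff intro: ta_lam elim!: taylor_LLamE) (metis Nf_RLam image_eqI ta_lam)

text \<open>The class is closed under reduction and contains no abstraction, so an application whose
  function part belongs to it never becomes a redex at its root.\<close>

inductive var_headed :: "rterm \<Rightarrow> bool" where
  "var_headed (RVar y)"
| "var_headed s \<Longrightarrow> var_headed (RApp s U)"

lemma var_headed_not_RLam: "\<not> var_headed (RLam s)"
  by (auto elim: var_headed.cases)

lemma rred_RApp_var_headed:
  assumes "rred (RApp s U) v" "var_headed s"
  shows "(\<exists>s'. v = RApp s' U \<and> rred s s') \<or>
    (\<exists>u u' V. U = add_mset u V \<and> v = RApp s (add_mset u' V) \<and> rred u u')"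
proof -
  from assms(1) obtain S where S: "rstep (RApp s U) S" "v \<in> S" by (auto simp: rred_def)
  from S(1) show ?thesis
  proof (cases rule: rstep_RAppE)
    case (redex p)
    then show ?thesis using assms(2) var_headed_not_RLam by blast
  next
    case (fn S')
    then show ?thesis using S(2) rredI[OF fn(2)] by blast
  next
    case (arg u S' V)
    then show ?thesis using S(2) rredI[OF arg(3)] by blast
  qed
qed

lemma var_headed_rred: "var_headed s \<Longrightarrow> rred s s' \<Longrightarrow> var_headed s'"
proof (induction arbitrary: s' rule: var_headed.induct)
  case (1 y)
  then show ?case by (auto simp: rred_def elim: rstep_RVarE)
next
  case (2 s U)
  from rred_RApp_var_headed[OF 2(3,1)] show ?case using 2 by (auto intro: var_headed.intros)
qed

lemma var_headed_rreds: "rred\<^sup>*\<^sup>* s s' \<Longrightarrow> var_headed s \<Longrightarrow> var_headed s'"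
  by (induction rule: rtranclp_induct) (auto intro: var_headed_rred)

lemma rreds_RApp_var_headed:
  assumes "rred\<^sup>*\<^sup>* (RApp s U) v" "var_headed s"
  shows "\<exists>s' U'. v = RApp s' U' \<and> rred\<^sup>*\<^sup>* s s' \<and> rel_mset rred\<^sup>*\<^sup>* U U'"
  using assms(1)
proof (induction rule: rtranclp_induct)
  case base
  have "rel_mset rred\<^sup>*\<^sup>* U U" by (rule multiset.rel_refl) simp
  then show ?case by blast
next
  case (step v w)
  then obtain s' U' where v: "v = RApp s' U'" "rred\<^sup>*\<^sup>* s s'" "rel_mset rred\<^sup>*\<^sup>* U U'" by blast
  have "rred (RApp s' U') w" using step(2) v(1) by simp
  from rred_RApp_var_headed[OF this var_headed_rreds[OF v(2) assms(2)]] show ?case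
  proof
    assume "\<exists>s''. w = RApp s'' U' \<and> rred s' s''"
    then obtain s'' where w: "w = RApp s'' U'" "rred s' s''" by blast
    have "rred\<^sup>*\<^sup>* s s''" using v(2) w(2) by (rule rtranclp.rtrancl_into_rtrancl)
    then show ?thesis using w(1) v(3) by blast
  next
    assume "\<exists>u u' V. U' = add_mset u V \<and> w = RApp s' (add_mset u' V) \<and> rred u u'"
    then obtain u u' V where w: "U' = add_mset u V" "w = RApp s' (add_mset u' V)" "rred u u'" by blast
    from v(3) w(1) obtain a A where A: "U = add_mset a A" "rred\<^sup>*\<^sup>* a u" "rel_mset rred\<^sup>*\<^sup>* A V"
      using msed_rel_invR by metis
    have "rred\<^sup>*\<^sup>* a u'" using A(2) w(3) by (rule rtranclp.rtrancl_into_rtrancl)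
    then have "rel_mset rred\<^sup>*\<^sup>* U (add_mset u' V)" unfolding A(1) using A(3) by (rule rel_mset_Plus)
    then show ?thesis using w(2) v(2) by blast
  qed
qed

lemma normal_RApp_var_headed:
  assumes "var_headed s"
  shows "(\<forall>S. \<not> rstep (RApp s U) S) \<longleftrightarrow> (\<forall>S. \<not> rstep s S) \<and> (\<forall>u\<in>#U. \<forall>S. \<not> rstep u S)"
proof
  assume n: "\<forall>S. \<not> rstep (RApp s U) S"
  then show "(\<forall>S. \<not> rstep s S) \<and> (\<forall>u\<in>#U. \<forall>S. \<not> rstep u S)"
    using rs_fun rs_arg by (metis mset_add)
next
  assume n: "(\<forall>S. \<not> rstep s S) \<and> (\<forall>u\<in>#U. \<forall>S. \<not> rstep u S)"
  show "\<forall>S. \<not> rstep (RApp s U) S"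
  proof (intro allI notI)
    fix S assume "rstep (RApp s U) S"
    then show False
    proof (cases rule: rstep_RAppE)
      case (redex p)
      then show False using assms var_headed_not_RLam by blast
    next
      case (fn S')
      then show False using n by blast
    next
      case (arg u S' V)
      then show False using n by (metis union_single_eq_member)
    qed
  qed
qed

text \<open>As no root redex can appear, the function part and the individual occurrences in the bag
  reduce independently of each other.\<close>

lemma Nf_RApp_var_headed:
  assumes "var_headed s"
  shows "u \<in> Nf (RApp s U) \<longleftrightarrow> (\<exists>s' U'. u = RApp s' U' \<and> s' \<in> Nf s \<and> rel_mset (\<lambda>t t'. t' \<in> Nf t) U U')"
proof
  assume "u \<in> Nf (RApp s U)"
  then have u: "rred\<^sup>*\<^sup>* (RApp s U) u" "\<forall>S. \<not> rstep u S" by (auto simp: Nf_def)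
  from rreds_RApp_var_headed[OF u(1) assms] obtain s' U' where
    *: "u = RApp s' U'" "rred\<^sup>*\<^sup>* s s'" "rel_mset rred\<^sup>*\<^sup>* U U'" by blast
  have n: "\<forall>S. \<not> rstep s' S" "\<forall>u\<in>#U'. \<forall>S. \<not> rstep u S"
    using u(2) *(1) normal_RApp_var_headed[OF var_headed_rreds[OF *(2) assms]] by simp_all
  have "rel_mset (\<lambda>t t'. t' \<in> Nf t) U U'"
    using *(3) by (rule multiset.rel_mono_strong) (use n(2) in \<open>auto simp: Nf_def\<close>)
  moreover have "s' \<in> Nf s" using *(2) n(1) by (simp add: Nf_def)
  ultimately show "\<exists>s' U'. u = RApp s' U' \<and> s' \<in> Nf s \<and> rel_mset (\<lambda>t t'. t' \<in> Nf t) U U'"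
    using *(1) by blast
next
  assume "\<exists>s' U'. u = RApp s' U' \<and> s' \<in> Nf s \<and> rel_mset (\<lambda>t t'. t' \<in> Nf t) U U'"
  then obtain s' U' where *: "u = RApp s' U'" "s' \<in> Nf s" "rel_mset (\<lambda>t t'. t' \<in> Nf t) U U'" by blast
  from *(3) have "rel_mset rred\<^sup>*\<^sup>* U U' \<and> (\<forall>u\<in>#U'. \<forall>S. \<not> rstep u S)"
    by (induction rule: rel_mset_induct_fixed) (auto simp: Nf_def intro: rel_mset_Zero rel_mset_Plus)
  moreover have "rred\<^sup>*\<^sup>* s s'" "\<forall>S. \<not> rstep s' S" using *(2) by (auto simp: Nf_def)
  ultimately show "u \<in> Nf (RApp s U)"
    using *(1) normal_RApp_var_headed[OF var_headed_rreds[OF _ assms], of s' U'] rreds_RApp[of s s' U U']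
    by (simp add: Nf_def)
qed

lemma taylor_var_headed: "taylor_approx s (apps (LVar y) Ns) \<Longrightarrow> var_headed s"
proof (induction Ns arbitrary: s rule: rev_induct)
  case Nil
  then show ?case by (auto elim: taylor_LVarE intro: var_headed.intros)
next
  case (snoc N Ns)
  then show ?case by (auto elim!: taylor_LAppE intro: var_headed.intros)
qed

text \<open>The elements of \<open>U\<close> may stem from different approximants of
  \<open>N\<close>. One source is picked for each occurrence, and any finite bag of approximants of
  \<open>N\<close> is allowed as an argument.\<close>

lemma NF_Taylor_LApp:
  "u \<in> NF_Taylor (LApp (apps (LVar y) Ns) N) \<longleftrightarrow>
    (\<exists>h U. u = RApp h U \<and> h \<in> NF_Taylor (apps (LVar y) Ns) \<and> (\<forall>t\<in>#U. t \<in> NF_Taylor N))"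
proof
  assume "u \<in> NF_Taylor (LApp (apps (LVar y) Ns) N)"
  then obtain s T where s: "taylor_approx s (apps (LVar y) Ns)" "\<forall>t\<in>#T. taylor_approx t N" "u \<in> Nf (RApp s T)"
    by (auto simp: NF_Taylor_def elim!: taylor_LAppE)
  from s(3) Nf_RApp_var_headed[OF taylor_var_headed[OF s(1)]] obtain h U where
    u: "u = RApp h U" "h \<in> Nf s" "rel_mset (\<lambda>t t'. t' \<in> Nf t) T U" by blast
  from u(3) s(2) have "\<forall>t\<in>#U. t \<in> NF_Taylor N"
    by (induction rule: rel_mset_induct_fixed) (auto simp: NF_Taylor_def)
  then show "\<exists>h U. u = RApp h U \<and> h \<in> NF_Taylor (apps (LVar y) Ns) \<and> (\<forall>t\<in>#U. t \<in> NF_Taylor N)"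
    using u(1,2) s(1) unfolding NF_Taylor_def by blast
next
  assume "\<exists>h U. u = RApp h U \<and> h \<in> NF_Taylor (apps (LVar y) Ns) \<and> (\<forall>t\<in>#U. t \<in> NF_Taylor N)"
  then obtain h U where u: "u = RApp h U" "h \<in> NF_Taylor (apps (LVar y) Ns)" "\<forall>t\<in>#U. t \<in> NF_Taylor N" by blast
  from u(2) obtain s where s: "taylor_approx s (apps (LVar y) Ns)" "h \<in> Nf s" by (auto simp: NF_Taylor_def)
  have "\<forall>t'\<in>#U. \<exists>t. taylor_approx t N \<and> t' \<in> Nf t" using u(3) by (auto simp: NF_Taylor_def)
  from mset_choice[OF this] obtain T where T: "rel_mset (\<lambda>t' t. taylor_approx t N \<and> t' \<in> Nf t) U T" by blast
  then have T: "(\<forall>t\<in>#T. taylor_approx t N) \<and> rel_mset (\<lambda>t t'. t' \<in> Nf t) T U"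
    by (induction rule: rel_mset_induct_fixed) (auto intro: rel_mset_Zero rel_mset_Plus)
  have "u \<in> Nf (RApp s T)"
    using Nf_RApp_var_headed[OF taylor_var_headed[OF s(1)]] u(1) s(2) T by blast
  moreover have "taylor_approx (RApp s T) (LApp (apps (LVar y) Ns) N)" using s(1) T by (blast intro: ta_app)
  ultimately show "u \<in> NF_Taylor (LApp (apps (LVar y) Ns) N)" unfolding NF_Taylor_def by blast
qed

section \<open>Solvability and Boehm trees\<close>

lemma abs_ren_lift: "k \<le> d \<Longrightarrow> abs_ren j (Suc d) (lift k N) = lift k (abs_ren j d N)"
proof (coinduction arbitrary: k d N)
  case Eq_lterm
  then show ?case by (cases N) (auto 4 4)
qed

text \<open>The renaming works one level deeper on \<open>P\<close>, where the substituted variable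
  is still bound within the prefix. Coinduction has to be strong: at that variable both sides become
  the same renamed copy of \<open>N\<close>, and the comparison stops with equality.\<close>

lemma abs_ren_subst:
  "k \<le> d \<Longrightarrow> abs_ren j d (subst k N P) = subst k (abs_ren j d N) (abs_ren j (Suc d) P)"
proof (coinduction arbitrary: k d N P rule: lterm.coinduct_strong)
  case Eq_lterm
  show ?case
  proof (cases P)
    case (LVar i)
    have "abs_ren j d (subst k N P) = subst k (abs_ren j d N) (abs_ren j (Suc d) P)"
      using Eq_lterm LVar by auto
    then show ?thesis by simp
  next
    case (LLam Q)
    then show ?thesis using Eq_lterm by (auto simp: abs_ren_lift[symmetric])
  next
    case (LApp Q R)
    then show ?thesis using Eq_lterm by auto
  qed simp
qed

lemma is_LLam_abs_ren [simp]: "is_LLam (abs_ren j d M) = is_LLam M"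
  by (cases M) auto

lemma hred_abs_ren: "hred M M' \<Longrightarrow> hred (abs_ren j d M) (abs_ren j d M')"
proof (induction arbitrary: d rule: hred.induct)
  case (hred_redex P Q)
  then show ?case by (simp add: beta_contract_def abs_ren_subst hred.hred_redex[unfolded beta_contract_def])
qed (auto intro: hred.intros)

inductive_cases hred_LLamE: "hred (LLam P) X"

text \<open>Renaming changes only variables, so it creates no redex. This reflection of head steps
  is what strips the abstractions off a solvability context.\<close>

lemma hred_abs_ren_inv: "hred A X \<Longrightarrow> A = abs_ren j d M \<Longrightarrow> \<exists>M'. X = abs_ren j d M' \<and> hred M M'"
proof (induction arbitrary: d M rule: hred.induct)
  case (hred_redex P Q)
  then obtain P1 Q1 where M: "M = LApp P1 Q1" "LLam P = abs_ren j d P1" "Q = abs_ren j d Q1"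
    by (cases M) auto
  from M(2) obtain P2 where P2: "P1 = LLam P2" "P = abs_ren j (Suc d) P2" by (cases P1) auto
  have "beta_contract P Q = abs_ren j d (beta_contract P2 Q1)"
    by (simp add: beta_contract_def abs_ren_subst P2(2) M(3))
  then show ?case using M(1) P2(1) hred.hred_redex by blast
next
  case (hred_lam P P')
  then obtain P1 where M: "M = LLam P1" "P = abs_ren j (Suc d) P1" by (cases M) auto
  from hred_lam.IH[OF M(2)] obtain P2 where "P' = abs_ren j (Suc d) P2" "hred P1 P2" by blast
  then show ?case using M(1) hred.hred_lam by (intro exI[of _ "LLam P2"]) simp
next
  case (hred_app P P' Q)
  then obtain P1 Q1 where M: "M = LApp P1 Q1" "P = abs_ren j d P1" "Q = abs_ren j d Q1"
    by (cases M) auto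
  from hred_app.IH[OF M(2)] obtain P2 where "P' = abs_ren j d P2" "hred P1 P2" by blast
  then show ?case using M hred_app.hyps(2) hred.hred_app by (intro exI[of _ "LApp P2 Q1"]) simp
qed

lemma hreds_abs_ren: "hred\<^sup>*\<^sup>* M M' \<Longrightarrow> hred\<^sup>*\<^sup>* (abs_ren j d M) (abs_ren j d M')"
  by (induction rule: rtranclp_induct) (auto intro: hred_abs_ren rtranclp.rtrancl_into_rtrancl)

lemma hreds_abs_ren_inv:
  "hred\<^sup>*\<^sup>* (abs_ren j d M) X \<Longrightarrow> \<exists>M'. X = abs_ren j d M' \<and> hred\<^sup>*\<^sup>* M M'"
proof (induction rule: rtranclp_induct)
  case (step X Y)
  then obtain M' where M': "X = abs_ren j d M'" "hred\<^sup>*\<^sup>* M M'" by blast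
  from hred_abs_ren_inv[OF step(2) M'(1)] obtain M'' where "Y = abs_ren j d M''" "hred M' M''" by blast
  then show ?case using M'(2) rtranclp.rtrancl_into_rtrancl[of hred M M' M''] by blast
qed blast

lemma abs_ren_lams: "abs_ren j d (lams m P) = lams m (abs_ren j (d + m) P)"
  by (induction m arbitrary: d) auto

lemma abs_ren_apps: "abs_ren j d (apps H Ns) = apps (abs_ren j d H) (map (abs_ren j d) Ns)"
  by (induction Ns arbitrary: H) auto

lemma abs_ren_apps_inv:
  "abs_ren j d M = apps (LVar y) Ns \<Longrightarrow> \<exists>y' Ns'. M = apps (LVar y') Ns'"
proof (induction Ns arbitrary: M rule: rev_induct)
  case Nil
  then obtain i where "M = LVar i" by (cases M) auto
  then have "M = apps (LVar i) []" by simp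
  then show ?case by blast
next
  case (snoc N Ns)
  then obtain P Q where M: "M = LApp P Q" "abs_ren j d P = apps (LVar y) Ns" by (cases M) auto
  from snoc.IH[OF M(2)] obtain y' Ns' where "P = apps (LVar y') Ns'" by blast
  with M(1) have "M = apps (LVar y') (Ns' @ [Q])" by simp
  then show ?case by blast
qed

lemma abs_ren_hnf_inv:
  "abs_ren j d M = lams m (apps (LVar y) Ns) \<Longrightarrow> \<exists>m' y' Ns'. M = lams m' (apps (LVar y') Ns')"
proof (induction m arbitrary: d M)
  case 0
  then show ?case using abs_ren_apps_inv lams_simps(1) by metis
next
  case (Suc m)
  then obtain P where P: "M = LLam P" "abs_ren j (Suc d) P = lams m (apps (LVar y) Ns)" by (cases M) auto
  from Suc.IH[OF P(2)] P(1) show ?case using lams_simps(2) by metis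
qed

lemma hreds_LLam_inv: "hred\<^sup>*\<^sup>* (LLam P) X \<Longrightarrow> \<exists>P'. X = LLam P' \<and> hred\<^sup>*\<^sup>* P P'"
proof (induction rule: rtranclp_induct)
  case (step X Y)
  then obtain P' where P': "X = LLam P'" "hred\<^sup>*\<^sup>* P P'" by blast
  with step(2) obtain P'' where "Y = LLam P''" "hred P' P''" by (auto elim: hred_LLamE)
  then show ?case using P'(2) rtranclp.rtrancl_into_rtrancl[of hred P P' P''] by blast
qed blast

lemma apps_eq_LLam: "apps (LVar y) Ns \<noteq> LLam P"
  by (cases Ns rule: rev_cases) auto

text \<open>An abstraction reduces only to abstractions, so the head normal form has an outermost
  binder to drop; the rest is reflected through the renaming.\<close>

lemma has_hnf_abs_var:
  assumes "has_hnf (abs_var j M)"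
  shows "has_hnf M"
proof -
  from assms obtain m y Ns where "hred\<^sup>*\<^sup>* (LLam (abs_ren j 0 M)) (lams m (apps (LVar y) Ns))"
    unfolding has_hnf_def abs_var_def by blast
  from hreds_LLam_inv[OF this] obtain P where
    P: "lams m (apps (LVar y) Ns) = LLam P" "hred\<^sup>*\<^sup>* (abs_ren j 0 M) P" by blast
  from hreds_abs_ren_inv[OF P(2)] obtain M' where M': "P = abs_ren j 0 M'" "hred\<^sup>*\<^sup>* M M'" by blast
  from P(1) obtain m' where "m = Suc m'" by (cases m) (auto simp: apps_eq_LLam)
  with P(1) M'(1) have "abs_ren j 0 M' = lams m' (apps (LVar y) Ns)" by simp
  from abs_ren_hnf_inv[OF this] M'(2) show ?thesis unfolding has_hnf_def by metis
qed

section \<open>From solvability to head normal forms\<close>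

text \<open>A term without normal forms can take a step, and so can the application in its function
  part. By termination this continues until the sum is empty, whatever the bag contains.\<close>

lemma Nf_RApp_empty: "Nf s = {} \<Longrightarrow> Nf (RApp s U) = {}"
proof (induction "rsize s" arbitrary: s rule: less_induct)
  case less
  obtain S where S: "rstep s S" using less.prems Nf_normal[of s] by blast
  have "Nf (RApp s' U) = {}" if "s' \<in> S" for s'
    using less.hyps[OF rsize_rstep[OF S that]] less.prems Nf_rstep[OF S] that by blast
  then show ?case using Nf_rstep[OF rs_fun[OF S, of U]] by simp
qed

lemma NF_Taylor_apps_nonempty: "NF_Taylor (apps M Ns) \<noteq> {} \<Longrightarrow> NF_Taylor M \<noteq> {}"
proof (induction Ns arbitrary: M)
  case (Cons N Ns)
  then have "NF_Taylor (LApp M N) \<noteq> {}" by simp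
  then obtain s U u where "taylor_approx s M" "u \<in> Nf (RApp s U)"
    by (auto simp: NF_Taylor_def elim!: taylor_LAppE)
  then show ?case using Nf_RApp_empty[of s U] unfolding NF_Taylor_def by blast
qed simp

text \<open>The target contains no application, so the coinductive premise never occurs and the
  derivation is made of two finite reductions.\<close>

lemma beta_inf_I:
  assumes "beta_inf M (LLam (LVar x))"
  shows "beta_star M (LLam (LVar x))"
proof -
  from assms have "binf_step beta_inf M (LLam (LVar x))" by cases
  then obtain P where P: "beta_star M (LLam P)" "binf_step beta_inf P (LVar x)"
    by (auto elim: binf_step.cases)
  from P(2) have "beta_star P (LVar x)" by (auto elim: binf_step.cases)
  then have "beta_star (LLam P) (LLam (LVar x))"
    by (induction rule: rtranclp_induct) (auto intro: beta_lam rtranclp.rtrancl_into_rtrancl)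
  then show ?thesis using P(1) by (simp add: rtranclp_trans)
qed

lemma solvable_has_hnf:
  assumes "solvable M"
  shows "has_hnf M"
proof -
  from assms obtain xs Ns where "beta_inf (apps (foldr abs_var xs M) Ns) (LLam (LVar 0))"
    unfolding solvable_def by blast
  from NF_Taylor_betas[OF beta_inf_I[OF this]] have "NF_Taylor (apps (foldr abs_var xs M) Ns) \<noteq> {}"
    by (auto simp: NF_Taylor_LLam NF_Taylor_LVar)
  from NF_Taylor_apps_nonempty[OF this] have "has_hnf (foldr abs_var xs M)" using NF_Taylor_has_hnf by blast
  then show ?thesis by (induction xs) (auto dest: has_hnf_abs_var)
qed

section \<open>From head normal forms to solvability\<close>

text \<open>The closed term that discards \<open>n\<close> arguments and returns the identity.\<close>
definition eat :: "nat \<Rightarrow> lterm" where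
  "eat n = lams n (LLam (LVar 0))"

lemma lift_lams: "lift k (lams m P) = lams m (lift (k + m) P)"
  by (induction m arbitrary: k) auto

lemma lift_eat [simp]: "lift k (eat n) = eat n"
  by (simp add: eat_def lift_lams)

lemma subst_eat [simp]: "subst k N (eat n) = eat n"
proof -
  have "subst k N (lams n (LLam (LVar 0))) = lams n (LLam (LVar 0))"
    by (induction n arbitrary: k N) auto
  then show ?thesis by (simp add: eat_def)
qed

lemma beta_apps: "beta M M' \<Longrightarrow> beta (apps M Ns) (apps M' Ns)"
  by (induction Ns arbitrary: M M') (auto intro: beta_fun)

lemma betas_apps: "beta_star M M' \<Longrightarrow> beta_star (apps M Ns) (apps M' Ns)"
  by (induction rule: rtranclp_induct) (auto intro: beta_apps rtranclp.rtrancl_into_rtrancl)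

lemma betas_eat_apps: "length Ns = n \<Longrightarrow> beta_star (apps (eat n) Ns) (LLam (LVar 0))"
proof (induction n arbitrary: Ns)
  case 0
  then show ?case by (simp add: eat_def)
next
  case (Suc n)
  then obtain N Ns' where Ns: "Ns = N # Ns'" "length Ns' = n" by (cases Ns) auto
  have "beta (LApp (eat (Suc n)) N) (eat n)"
    using beta_redex[of "eat n" N] by (simp add: beta_contract_def) (simp add: eat_def)
  then have "beta (apps (eat (Suc n)) Ns) (apps (eat n) Ns')" using beta_apps Ns(1) by simp
  then show ?case using Suc.IH[OF Ns(2)] by (rule converse_rtranclp_into_rtranclp)
qed

lemma subst_lams_apps_eat:
  "subst k (eat n) (lams m (apps H Ns)) =
    lams m (apps (subst (k + m) (eat n) H) (map (subst (k + m) (eat n)) Ns))"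
proof (induction m arbitrary: k)
  case 0
  show ?case by (simp, induction Ns arbitrary: H) auto
qed auto

text \<open>Every binder receives the same \<open>eat n\<close>, so it does not matter which of them
  binds the head. The disjunction on \<open>H\<close> is the invariant while binders are consumed:
  the head is still bound, or it has already been replaced and will discard its \<open>n\<close>
  arguments.\<close>

lemma betas_lams_apps_eat:
  assumes "H = eat n \<or> (\<exists>y<m. H = LVar y)" "length Ns = n"
  shows "beta_star (apps (lams m (apps H Ns)) (replicate m (eat n))) (LLam (LVar 0))"
  using assms
proof (induction m arbitrary: H Ns)
  case 0
  then show ?case by (simp add: betas_eat_apps)
next
  case (Suc m)
  let ?H = "subst m (eat n) H" and ?Ns = "map (subst m (eat n)) Ns"
  have "beta (LApp (lams (Suc m) (apps H Ns)) (eat n)) (lams m (apps ?H ?Ns))"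
    using beta_redex[of "lams m (apps H Ns)" "eat n"] by (simp add: beta_contract_def subst_lams_apps_eat)
  then have "beta (apps (lams (Suc m) (apps H Ns)) (replicate (Suc m) (eat n)))
      (apps (lams m (apps ?H ?Ns)) (replicate m (eat n)))"
    using beta_apps by simp
  \<comment> \<open>The binder just consumed has index \<open>m\<close> at the head. A head with
    that index is replaced, and a smaller one is unchanged and bound by the remaining
    prefix.\<close>
  moreover have "?H = eat n \<or> (\<exists>y<m. ?H = LVar y)" using Suc.prems(1) by (auto simp: less_Suc_eq)
  then have "beta_star (apps (lams m (apps ?H ?Ns)) (replicate m (eat n))) (LLam (LVar 0))"
    using Suc.prems(2) by (intro Suc.IH) auto
  ultimately show ?case by (rule converse_rtranclp_into_rtranclp)
qed

lemma eat_Lambda001: "eat n \<in> Lambda001"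
proof -
  have *: "\<exists>m. N = lams m (LVar 0)" if "subterm N (lams m (LVar 0))" for N m
    using that
  proof (induction m)
    case 0
    then have "N = lams 0 (LVar 0)" by (auto elim: subterm.cases)
    then show ?case by blast
  next
    case (Suc m)
    then have "N = lams (Suc m) (LVar 0) \<or> subterm N (lams m (LVar 0))" by (auto elim: subterm.cases)
    then show ?case using Suc.IH by blast
  qed
  have spine: "spine_fin (lams m (LVar 0))" for m by (induction m) (auto intro: spine_fin.intros)
  have nobot: "lams m (LVar 0) \<noteq> LBot" for m by (cases m) auto
  \<comment> \<open>Moving the last abstraction into the prefix gives a family of terms that is
    closed under subterms.\<close>
  have eat: "eat n = lams (Suc n) (LVar 0)" unfolding eat_def by (induction n) auto
  show ?thesis unfolding Lambda001_def is001_def eat mem_Collect_eq using * spine nobot by metis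
qed

lemma betas_hreds: "hred\<^sup>*\<^sup>* M M' \<Longrightarrow> beta_star M M'"
  by (induction rule: rtranclp_induct) (auto intro: hred_beta rtranclp.rtrancl_into_rtrancl)

lemma hreds_LLam: "hred\<^sup>*\<^sup>* M M' \<Longrightarrow> hred\<^sup>*\<^sup>* (LLam M) (LLam M')"
  by (induction rule: rtranclp_induct) (auto intro: hred_lam rtranclp.rtrancl_into_rtrancl)

lemma has_hnf_solvable:
  assumes "has_hnf M"
  shows "solvable M"
proof -
  from assms obtain m y Ns where M: "hred\<^sup>*\<^sup>* M (lams m (apps (LVar y) Ns))"
    unfolding has_hnf_def by blast
  obtain xs m' y' Ns' where *: "hred\<^sup>*\<^sup>* (foldr abs_var xs M) (lams m' (apps (LVar y') Ns'))" "y' < m'"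
  proof (cases "y < m")
    case True
    then show thesis using that[of "[]"] M by simp
  next
    \<comment> \<open>The head variable is free: below \<open>m\<close> binders, index
      \<open>y\<close> stands for the name \<open>y - m\<close>. Abstracting this name adds an
      outermost binder, and the head becomes its index \<open>m\<close>.\<close>
    case False
    have "hred\<^sup>*\<^sup>* (abs_var (y - m) M) (LLam (abs_ren (y - m) 0 (lams m (apps (LVar y) Ns))))"
      unfolding abs_var_def by (intro hreds_LLam hreds_abs_ren M)
    then have "hred\<^sup>*\<^sup>* (foldr abs_var [y - m] M) (lams (Suc m) (apps (LVar m) (map (abs_ren (y - m) m) Ns)))"
      using False by (simp add: abs_ren_lams abs_ren_apps)
    then show thesis using that lessI by blast
  qed
  let ?Ks = "replicate m' (eat (length Ns'))"
  have "beta_star (apps (foldr abs_var xs M) ?Ks) (LLam (LVar 0))"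
    using betas_apps[OF betas_hreds[OF *(1)], of ?Ks]
      betas_lams_apps_eat[of "LVar y'" "length Ns'" m' Ns'] *(2)
    by (simp add: rtranclp_trans)
  then have "beta_inf (apps (foldr abs_var xs M) ?Ks) (LLam (LVar 0))"
    by (intro beta_inf.intros binf_lam[OF _ binf_var]) auto
  moreover have "set ?Ks \<subseteq> Lambda001" using eat_Lambda001 by auto
  ultimately show ?thesis unfolding solvable_def by blast
qed

section \<open>Boehm trees and the comparison of the two sets\<close>

lemma bt_aux_simps [simp]:
  "bt_aux BBot = LBot"
  "bt_aux (BLams (Suc m) y L) = LLam (bt_aux (BLams m y L))"
  "bt_aux (BLams 0 y []) = LVar y"
  "bt_aux (BLams 0 y (N # L)) = LApp (bt_aux (BLams 0 y L)) (BT N)"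
  unfolding BT_def by (subst bt_aux.code, simp)+

text \<open>Walking along the binders and the spine keeps the size of \<open>u\<close> at most
  \<open>n\<close>, and only elements of bags, which are strictly smaller, meet the trees of the
  arguments. The bound in the first assumption is thus exactly what an induction on size
  provides.\<close>

lemma NF_Taylor_hnf_bt_aux:
  assumes "\<And>N v. N \<in> set Ns \<Longrightarrow> rsize v < n \<Longrightarrow> v \<in> NF_Taylor N \<longleftrightarrow> taylor_approx v (BT N)"
    and "rsize u \<le> n"
  shows "u \<in> NF_Taylor (lams m (apps (LVar y) Ns)) \<longleftrightarrow> taylor_approx u (bt_aux (BLams m y (rev Ns)))"
  using assms(2)
proof (induction m arbitrary: u)
  case 0
  from assms(1) 0 have "u \<in> NF_Taylor (apps (LVar y) Ns) \<longleftrightarrow> taylor_approx u (bt_aux (BLams 0 y (rev Ns)))"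
  \<comment> \<open>The state lists the arguments in reverse: its first entry belongs to the
    outermost application, so \<open>Ns\<close> is taken apart from its end.\<close>
  proof (induction Ns arbitrary: u rule: rev_induct)
    case Nil
    then show ?case by (auto simp: NF_Taylor_LVar intro: ta_var elim: taylor_LVarE)
  next
    case (snoc N Ns)
    show ?case
    proof (cases u)
      case (RApp h U)
      have "h \<in> NF_Taylor (apps (LVar y) Ns) \<longleftrightarrow> taylor_approx h (bt_aux (BLams 0 y (rev Ns)))"
        using snoc.prems RApp by (intro snoc.IH) auto
      moreover have "t \<in> NF_Taylor N \<longleftrightarrow> taylor_approx t (BT N)" if t: "t \<in># U" for t
      proof (rule snoc.prems(1))
        obtain V where "U = add_mset t V" using t by (rule mset_add)
        then show "rsize t < n" using snoc.prems(2) RApp by simp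
      qed simp
      ultimately show ?thesis unfolding RApp by (auto simp: NF_Taylor_LApp intro: ta_app elim: taylor_LAppE)
    qed (auto simp: NF_Taylor_LApp elim: taylor_LAppE)
  qed
  then show ?case by simp
next
  case (Suc m)
  show ?case
  proof (cases u)
    case (RLam s)
    with Suc have "s \<in> NF_Taylor (lams m (apps (LVar y) Ns)) \<longleftrightarrow> taylor_approx s (bt_aux (BLams m y (rev Ns)))"
      by simp
    then show ?thesis unfolding RLam by (auto simp: NF_Taylor_LLam intro: ta_lam elim: taylor_LLamE)
  qed (auto simp: NF_Taylor_LLam elim: taylor_LLamE)
qed

text \<open>Membership of the finite term \<open>u\<close> inspects only a finite part of the
  corecursive tree. \<open>M\<close> stays arbitrary in the induction, because elements of bags in
  \<open>u\<close> are compared with the arguments of a head normal form.\<close>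

lemma NF_Taylor_BT: "u \<in> NF_Taylor M \<longleftrightarrow> taylor_approx u (BT M)"
proof (induction "rsize u" arbitrary: u M rule: less_induct)
  case less
  show ?case
  proof (cases "solvable M")
    case False
    then have "BT M = LBot" by (simp add: BT_def bt_start_def)
    moreover have "u \<notin> NF_Taylor M" using False has_hnf_solvable NF_Taylor_has_hnf by blast
    ultimately show ?thesis by (auto elim: taylor_LBotE)
  next
    case True
    let ?P = "\<lambda>(m, y, Ns). hred\<^sup>*\<^sup>* M (lams m (apps (LVar y) Ns))"
    obtain m y Ns where hnf: "(SOME (m, y, Ns). hred\<^sup>*\<^sup>* M (lams m (apps (LVar y) Ns))) = (m, y, Ns)"
      using prod_cases3 by blast
    \<comment> \<open>Solvability provides a head normal form, so the triple picked by
      \<open>SOME\<close> in \<open>bt_start\<close> is really reached by head reduction from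
      \<open>M\<close>.\<close>
    have "\<exists>z. ?P z" using solvable_has_hnf[OF True] by (auto simp: has_hnf_def)
    from someI_ex[OF this] have "hred\<^sup>*\<^sup>* M (lams m (apps (LVar y) Ns))" using hnf by simp
    then have "NF_Taylor M = NF_Taylor (lams m (apps (LVar y) Ns))" by (rule NF_Taylor_hreds)
    moreover have "BT M = bt_aux (BLams m y (rev Ns))" using True hnf by (simp add: BT_def bt_start_def)
    moreover have "u \<in> NF_Taylor (lams m (apps (LVar y) Ns)) \<longleftrightarrow> taylor_approx u (bt_aux (BLams m y (rev Ns)))"
      using less by (intro NF_Taylor_hnf_bt_aux[where n="rsize u"]) auto
    ultimately show ?thesis by simp
  qed
qed

theorem mainTheorem15:
  assumes "M \<in> Lambda001"
  shows "NF_r (Taylor M) = Taylor (BT M)"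
  unfolding NF_r_Taylor unfolding Taylor_def using NF_Taylor_BT by blast

end
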